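(* Let $0<\delta\le\pi$ and let $X$ be a w.s.s. random process whose autocorrelation function belongs to $\mathcal{B}_\delta$, so that $$R_X(t,\tau)=\int_{-\delta}^{\delta}e^{i(t-\tau)\xi}\rho(\xi)\,d\xi,\qquad t,\tau\in\mathbb{R},$$ for some nonnegative function $\rho\in L^2([-\delta,\delta])$ with $\|\rho\|_{L^2([-\delta,\delta])}>0$. Suppose that $\rho\in L^\infty([-\delta,\delta])$. Then for all $n\in\mathbb{N}$, $$\mathcal{E}_n(R_X)\le \|\sqrt{\rho}\|_{L^\infty([-\delta,\delta])}\,\sqrt{2+\pi-\delta}\;\frac{\sqrt{3}\,e}{\sqrt{\pi n}}\exp\left(-\frac{\pi-\delta}{2}n\right).$$
   Context: $\mathbb{N}$ denotes the positive integers and $J_n:=\{j\in\mathbb{Z}:-n+1\le j\le n\}$. $\mathcal{B}_\delta$ is the Paley-Wiener space of functions $f\in C(\mathbb{R})\cap L^2(\mathbb{R})$ with Fourier transform supported on $[-\delta,\delta]$. A random process $X=X(t,\omega)$ on a probability space $(\Omega,\mathscr{F},P)$ is w.s.s. (wide sense stationary) if $X(t,\cdot)\in L^2(\Omega,dP)$ for every $t\in\mathbb{R}$ and $R_X(t,\tau):=\int_\Omega X(t,\omega)\overline{X(\tau,\omega)}\,dP(\omega)$ depends only on $t-\tau$; $R_X\in\mathcal{B}_\delta$ means that $t\mapsto R_X(t,0)$ is in $\mathcal{B}_\delta$. For a positive-definite kernel $K:\mathbb{R}\times\mathbb{R}\to\mathbb{C}$ (all matrices $[K(t_j,t_k)]$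 over finitely many distinct points hermitian positive semi-definite), $\mathcal{H}_K$ denotes the unique reproducing kernel Hilbert space of functions on $\mathbb{R}$ with $K(t,\cdot)\in\mathcal{H}_K$ and $f(t)=\langle f,K(t,\cdot)\rangle_{\mathcal{H}_K}$ for all $f\in\mathcal{H}_K$, $t\in\mathbb{R}$. $R_X(t,\tau)$ is such a kernel. $U(\mathcal{H})$ is the closed unit ball of a Hilbert space $\mathcal{H}$, and $\mathbb{C}^{J_n}$ the set of functions $J_n\to\mathbb{C}$. For a continuous translation-invariant kernel $K$ and a mapping $\mathcal{A}:\mathbb{C}^{J_n}\to L^\infty([0,1])$, put $\mathcal{E}_n(\mathcal{A},K):=\sup\{\|f-\mathcal{A}(f|_{J_n})\|_{L^\infty([0,1])}:f\in U(\mathcal{H}_K)\}$ and $\mathcal{E}_n(K):=\inf_{\mathcal{A}}\mathcal{E}_n(\mathcal{A},K)$, the infimum over all such mappings $\mathcal{A}$. It is known (and may be used as an equivalent definition) that $\mathcal{E}_n(K)=\sup\{\|f\|_{L^\infty([0,1])}:f\in U(\mathcal{H}_K),\ f(j)=0\ \forall j\in J_n\}$. *)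

theory Defs
  imports "HOL-Probability.Probability"
begin

definition L2_space :: "'a measure \<Rightarrow> ('a \<Rightarrow> 'b::{real_normed_vector, second_countable_topology}) set" where
  "L2_space M = {f \<in> borel_measurable M. integrable M (\<lambda>x. (norm (f x))\<^sup>2)}"

definition L2_norm :: "'a measure \<Rightarrow> ('a \<Rightarrow> 'b::{real_normed_vector, second_countable_topology}) \<Rightarrow> real" where
  "L2_norm M f = sqrt (LINT x|M. (norm (f x))\<^sup>2)"

definition Linf_norm :: "'a measure \<Rightarrow> ('a \<Rightarrow> 'b::real_normed_vector) \<Rightarrow> ennreal" where
  "Linf_norm M f = esssup M (\<lambda>x. ennreal (norm (f x)))"

definition Linf_space :: "'a measure \<Rightarrow> ('a \<Rightarrow> 'b::{real_normed_vector, second_countable_topology}) set" where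
  "Linf_space M = {f \<in> borel_measurable M. Linf_norm M f < \<infinity>}"

text \<open>\<open>g\<close> is an \<open>L\<^sup>2\<close> Fourier transform of \<open>f\<close> (Plancherel): the \<open>L\<^sup>2\<close> limit of the transforms of
  the truncations of \<open>f\<close> to \<open>[-r, r]\<close>. The \<open>L\<^sup>2\<close> distance is a nonnegative integral so that it
  cannot vanish through a failure of integrability.\<close>

definition is_L2_fourier :: "(real \<Rightarrow> complex) \<Rightarrow> (real \<Rightarrow> complex) \<Rightarrow> bool" where
  "is_L2_fourier f g \<longleftrightarrow> f \<in> L2_space lebesgue \<and> g \<in> L2_space lebesgue \<and>
     ((\<lambda>r::real. \<integral>\<^sup>+\<xi>. ennreal ((norm ((LINT t|lebesgue_on {-r..r}.
          exp (- \<i> * of_real (t * \<xi>)) * f t) - g \<xi>))\<^sup>2) \<partial>lebesgue) \<longlongrightarrow> 0) at_top"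

definition paley_wiener :: "real \<Rightarrow> (real \<Rightarrow> complex) set" where
  "paley_wiener \<delta> = {f. continuous_on UNIV f \<and> f \<in> L2_space lebesgue \<and>
     (\<exists>g. is_L2_fourier f g \<and> (AE \<xi> in lebesgue. \<xi> \<notin> {-\<delta>..\<delta>} \<longrightarrow> g \<xi> = 0))}"

definition autocorrelation :: "'a measure \<Rightarrow> (real \<Rightarrow> 'a \<Rightarrow> complex) \<Rightarrow> real \<Rightarrow> real \<Rightarrow> complex" where
  "autocorrelation M X t \<tau> = (LINT \<omega>|M. X t \<omega> * cnj (X \<tau> \<omega>))"

definition wide_sense_stationary :: "'a measure \<Rightarrow> (real \<Rightarrow> 'a \<Rightarrow> complex) \<Rightarrow> bool" where
  "wide_sense_stationary M X \<longleftrightarrow> prob_space M \<and> (\<forall>t. X t \<in> L2_space M) \<and>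
     (\<exists>r. \<forall>t \<tau>. autocorrelation M X t \<tau> = r (t - \<tau>))"

text \<open>A complex Hilbert space \<open>H\<close> of functions on the line, with inner product \<open>ip\<close> (linear in the
  first argument; only its values on \<open>H\<close> matter), having \<open>K\<close> as reproducing kernel.\<close>

locale reproducing_kernel_Hilbert_space =
  fixes K :: "real \<Rightarrow> real \<Rightarrow> complex"
    and H :: "(real \<Rightarrow> complex) set"
    and ip :: "(real \<Rightarrow> complex) \<Rightarrow> (real \<Rightarrow> complex) \<Rightarrow> complex"
  assumes zero_mem: "(\<lambda>t. 0) \<in> H"
    and add_mem: "\<And>f g. f \<in> H \<Longrightarrow> g \<in> H \<Longrightarrow> (\<lambda>t. f t + g t) \<in> H"
    and scale_mem: "\<And>c f. f \<in> H \<Longrightarrow> (\<lambda>t. c * f t) \<in> H"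
    and ip_add: "\<And>f g h. f \<in> H \<Longrightarrow> g \<in> H \<Longrightarrow> h \<in> H \<Longrightarrow> ip (\<lambda>t. f t + g t) h = ip f h + ip g h"
    and ip_scale: "\<And>c f g. f \<in> H \<Longrightarrow> g \<in> H \<Longrightarrow> ip (\<lambda>t. c * f t) g = c * ip f g"
    and ip_commute: "\<And>f g. f \<in> H \<Longrightarrow> g \<in> H \<Longrightarrow> ip f g = cnj (ip g f)"
    and ip_nonneg: "\<And>f. f \<in> H \<Longrightarrow> 0 \<le> Re (ip f f)"
    and ip_definite: "\<And>f. f \<in> H \<Longrightarrow> ip f f = 0 \<Longrightarrow> f = (\<lambda>t. 0)"
    and complete: "\<And>s :: nat \<Rightarrow> real \<Rightarrow> complex. range s \<subseteq> H \<Longrightarrow>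
      (\<forall>e>0. \<exists>N. \<forall>m\<ge>N. \<forall>k\<ge>N.
         sqrt (Re (ip (\<lambda>t. s m t - s k t) (\<lambda>t. s m t - s k t))) < e) \<Longrightarrow>
      \<exists>f\<in>H. (\<lambda>m. sqrt (Re (ip (\<lambda>t. s m t - f t) (\<lambda>t. s m t - f t)))) \<longlonglongrightarrow> 0"
    and kernel_mem: "\<And>t. K t \<in> H"
    and reproducing: "\<And>f t. f \<in> H \<Longrightarrow> f t = ip f (K t)"

text \<open>By the Moore--Aronszajn theorem, a positive-definite \<open>K\<close> has exactly one pair of \<open>H\<close> and
  (on \<open>H\<close>) \<open>ip\<close> as above, so that this is the closed unit ball of that one space.\<close>

definition rkhs_unit_ball :: "(real \<Rightarrow> real \<Rightarrow> complex) \<Rightarrow> (real \<Rightarrow> complex) set" where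
  "rkhs_unit_ball K = {f. \<exists>H ip. reproducing_kernel_Hilbert_space K H ip \<and> f \<in> H \<and>
     sqrt (Re (ip f f)) \<le> 1}"

definition J :: "nat \<Rightarrow> int set" where
  "J n = {- int n + 1 .. int n}"

text \<open>Functions on \<open>J n\<close> are encoded as extensional functions, and elements of \<open>L\<^sup>\<infinity>([0,1])\<close> by
  representatives.\<close>

definition recovery_maps :: "nat \<Rightarrow> ((int \<Rightarrow> complex) \<Rightarrow> real \<Rightarrow> complex) set" where
  "recovery_maps n = (J n \<rightarrow>\<^sub>E UNIV) \<rightarrow> Linf_space (lebesgue_on {0..1})"

definition recovery_error ::
  "nat \<Rightarrow> ((int \<Rightarrow> complex) \<Rightarrow> real \<Rightarrow> complex) \<Rightarrow> (real \<Rightarrow> real \<Rightarrow> complex) \<Rightarrow> ennreal" where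
  "recovery_error n \<A> K = (SUP f\<in>rkhs_unit_ball K.
     Linf_norm (lebesgue_on {0..1}) (\<lambda>t. f t - \<A> (restrict (\<lambda>j. f (of_int j)) (J n)) t))"

definition min_recovery_error :: "nat \<Rightarrow> (real \<Rightarrow> real \<Rightarrow> complex) \<Rightarrow> ennreal" where
  "min_recovery_error n K = (INF \<A>\<in>recovery_maps n. recovery_error n \<A> K)"

end

theory Submission
  imports Defs
begin

text \<open>
  By the reproducing property and the Cauchy--Schwarz inequality, the error at a point \<open>t\<close> of a
  linear reconstruction \<open>\<Sum>j\<in>J n. c j t * f j\<close>, for \<open>f\<close> in the unit ball of the space with kernel
  \<open>\<integral> exp (\<i> (t - \<tau>) \<xi>) \<rho> \<xi> d\<xi>\<close>, is at most the distance, in \<open>L\<^sup>2\<close> with weight \<open>\<rho>\<close>, of the exponential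
  \<open>exp (\<i> t \<xi>)\<close> from the trigonometric polynomial \<open>\<Sum>j\<in>J n. c j t * exp (\<i> j \<xi>)\<close>
  (\<open>rkhs_combination_error\<close>). Bounding \<open>\<rho>\<close> by its essential supremum leaves a problem without
  probability: approximate \<open>exp (\<i> t \<xi>)\<close> on \<open>[-\<delta>, \<delta>]\<close> by exponentials with frequencies in \<open>J n\<close>.

  The coefficients are those of a windowed sampling series, \<open>c j t = \<phi> (t - j) * sinc (pi (t - j))\<close>.
  Let \<open>a = pi - \<delta>\<close>. For \<open>\<phi> = 1\<close> the full series over all integers is the Fourier series of
  \<open>exp (\<i> t \<xi>)\<close> on \<open>[-pi, pi]\<close>. Multiplying the window by \<open>exp (\<i> \<theta> x)\<close> shifts \<open>\<xi>\<close> by \<open>\<theta>\<close>, so a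
  combination of exponentials with frequencies at most \<open>a\<close> in modulus and with \<open>\<phi> 0 = 1\<close> still
  reproduces \<open>exp (\<i> t \<xi>)\<close> on the smaller interval \<open>[-\<delta>, \<delta>]\<close>. Hence only the truncation to \<open>J n\<close>
  costs anything, and as \<open>\<bar>t - j\<bar> \<ge> n\<close> for \<open>t\<close> in \<open>[0, 1]\<close> and \<open>j\<close> outside \<open>J n\<close>, what is wanted is a window that is
  small away from \<open>(-n, n)\<close>.

  Such a window comes from the extremal property of the Chebyshev polynomial \<open>T\<close> of degree \<open>m\<close>:
  with \<open>\<theta> = a / m\<close>, the function \<open>T (cos (\<theta> x) / cos (\<theta> n)) / T (1 / cos (\<theta> n))\<close> has frequencies
  at most \<open>m \<theta> = a\<close>, is \<open>1\<close> at the origin, and is at most \<open>1 / cosh (a n)\<close> in modulus for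
  \<open>n \<le> \<bar>x\<bar> \<le> pi / \<theta> - n\<close> (\<open>chebyshev_window\<close>). It is periodic up to sign and so becomes large again, but
  only at a distance of order \<open>m\<close>, where the decay of \<open>sinc\<close> alone makes the tail negligible.
  The window decays like \<open>exp (- a n)\<close>, while the theorem asks for the rate \<open>exp (- a n / 2)\<close> only. So half of
  the exponent can be given away, and the numerical constants leave room for the two negligible
  terms, the far tail and the remainder of the series (\<open>trigonometric_approximation\<close>).
\<close>

section \<open>Fourier series of an exponential with real frequency\<close>

lemma has_integral_cos_sinc:
  "((\<lambda>\<xi>. cos (x * \<xi>)) has_integral 2 * pi * sinc (pi * x)) {-pi..pi}" for x :: real
proof (cases "x = 0")
  case True
  have "((\<lambda>\<xi>::real. 1::real) has_integral (1 * (pi - - pi))) {-pi..pi}"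
    using has_integral_const_real[of "1::real" "-pi" pi] by (simp add: mult.commute)
  then show ?thesis using True by simp
next
  case False
  have "((\<lambda>\<xi>. cos (x * \<xi>)) has_integral (sin (x * pi) / x - sin (x * (-pi)) / x)) {-pi..pi}"
    by (rule fundamental_theorem_of_calculus)
       (auto intro!: derivative_eq_intros
             simp: False has_real_derivative_iff_has_vector_derivative[symmetric])
  also have "sin (x * pi) / x - sin (x * (-pi)) / x = 2 * pi * sinc (pi * x)"
    using False by (simp add: mult.commute)
  finally show ?thesis .
qed

lemma norm_trig_sum_square:
  fixes c :: "'i \<Rightarrow> real" and x :: "'i \<Rightarrow> real"
  shows "(norm (\<Sum>i\<in>I. of_real (c i) * cis (x i * \<xi>)))\<^sup>2
    = (\<Sum>i\<in>I. \<Sum>k\<in>I. c i * c k * cos ((x i - x k) * \<xi>))"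
proof -
  have "(\<Sum>i\<in>I. \<Sum>k\<in>I. c i * c k * cos ((x i - x k) * \<xi>))
     = (\<Sum>i\<in>I. \<Sum>k\<in>I. (c i * cos (x i * \<xi>)) * (c k * cos (x k * \<xi>)))
     + (\<Sum>i\<in>I. \<Sum>k\<in>I. (c i * sin (x i * \<xi>)) * (c k * sin (x k * \<xi>)))"
    by (simp add: sum.distrib[symmetric] left_diff_distrib cos_diff algebra_simps)
  also have "\<dots> = (\<Sum>i\<in>I. c i * cos (x i * \<xi>))\<^sup>2 + (\<Sum>i\<in>I. c i * sin (x i * \<xi>))\<^sup>2"
    by (simp add: power2_eq_square sum_product)
  finally show ?thesis by (simp add: cmod_power2 Re_sum Im_sum)
qed

text \<open>The frequencies may be arbitrary reals: the Gram matrix of the exponentials on \<open>[-pi, pi]\<close> consists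
of \<open>sinc\<close> values, which for integer frequencies vanish off the diagonal.\<close>

lemma has_integral_norm_trig_sum:
  fixes c :: "'i \<Rightarrow> real" and x :: "'i \<Rightarrow> real"
  assumes "finite I"
  shows "((\<lambda>\<xi>. (norm (\<Sum>i\<in>I. of_real (c i) * cis (x i * \<xi>)))\<^sup>2) has_integral
    2 * pi * (\<Sum>i\<in>I. \<Sum>k\<in>I. c i * c k * sinc (pi * (x i - x k)))) {-pi..pi}"
proof -
  have "((\<lambda>\<xi>. \<Sum>i\<in>I. \<Sum>k\<in>I. c i * c k * cos ((x i - x k) * \<xi>)) has_integral
    (\<Sum>i\<in>I. \<Sum>k\<in>I. c i * c k * (2 * pi * sinc (pi * (x i - x k))))) {-pi..pi}"
    by (intro has_integral_sum assms has_integral_mult_right has_integral_cos_sinc)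
  then show ?thesis
    unfolding norm_trig_sum_square by (simp only: sum_distrib_left mult_ac)
qed

lemma sinc_pi_int: "sinc (pi * real_of_int (i - k)) = (if i = k then 1 else 0)"
  using sin_npi_int[of "i - k"] by auto

lemma has_integral_norm_trig_polynomial:
  fixes c :: "int \<Rightarrow> real"
  assumes "finite A"
  shows "((\<lambda>\<xi>. (norm (\<Sum>j\<in>A. of_real (c j) * cis (real_of_int j * \<xi>)))\<^sup>2) has_integral
    2 * pi * (\<Sum>j\<in>A. (c j)\<^sup>2)) {-pi..pi}"
proof -
  have "(\<Sum>i\<in>A. \<Sum>k\<in>A. c i * c k * sinc (pi * (real_of_int i - real_of_int k)))
     = (\<Sum>i\<in>A. \<Sum>k\<in>A. if i = k then c i * c k else 0)"
    using sinc_pi_int by (intro sum.cong refl) (auto simp flip: of_int_diff)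
  also have "\<dots> = (\<Sum>j\<in>A. (c j)\<^sup>2)"
    using assms by (simp add: power2_eq_square)
  finally show ?thesis using has_integral_norm_trig_sum[OF assms, of c "real_of_int"] by simp
qed

text \<open>The Fourier coefficients of \<open>exp (\<i> t \<xi>)\<close> on \<open>[-pi, pi]\<close> are \<open>sinc (pi (t - j))\<close>. By this identity the
convergence of the Fourier series in \<open>L\<^sup>2\<close> is equivalent to \<open>\<Sum>j. (sinc (pi (t - j)))\<^sup>2 = 1\<close>, and an
elementary trigonometric sum can take the place of the completeness of the trigonometric system.\<close>

lemma has_integral_fourier_error:
  assumes "finite A"
  shows "((\<lambda>\<xi>. (norm (cis (t * \<xi>) - (\<Sum>j\<in>A. of_real (sinc (pi * (t - real_of_int j))) *
             cis (real_of_int j * \<xi>))))\<^sup>2) has_integral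
    2 * pi * (1 - (\<Sum>j\<in>A. (sinc (pi * (t - real_of_int j)))\<^sup>2))) {-pi..pi}"
proof -
  define s where "s j = sinc (pi * (t - real_of_int j))" for j
  have expand: "(norm (cis (t * \<xi>) - (\<Sum>j\<in>A. of_real (s j) * cis (real_of_int j * \<xi>))))\<^sup>2
     = 1 - 2 * (\<Sum>j\<in>A. s j * cos ((t - real_of_int j) * \<xi>))
       + (norm (\<Sum>j\<in>A. of_real (s j) * cis (real_of_int j * \<xi>)))\<^sup>2" for \<xi>
  proof -
    have 1: "(norm (u - v))\<^sup>2 = (norm u)\<^sup>2 - 2 * Re (u * cnj v) + (norm v)\<^sup>2" for u v :: complex
      by (simp only: cmod_power2) (simp add: power2_eq_square algebra_simps)
    have 2: "Re (cis (t * \<xi>) * cnj (\<Sum>j\<in>A. of_real (s j) * cis (real_of_int j * \<xi>)))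
      = (\<Sum>j\<in>A. s j * cos ((t - real_of_int j) * \<xi>))"
      by (simp add: Re_sum Im_sum sum_distrib_left sum.distrib[symmetric] left_diff_distrib cos_diff
            algebra_simps)
    show ?thesis unfolding 1 2 by simp
  qed
  have one: "((\<lambda>\<xi>::real. 1::real) has_integral 2 * pi) {-pi..pi}"
    using has_integral_const_real[of "1::real" "-pi" pi] by simp
  have "((\<lambda>\<xi>. 1 - 2 * (\<Sum>j\<in>A. s j * cos ((t - real_of_int j) * \<xi>))
       + (norm (\<Sum>j\<in>A. of_real (s j) * cis (real_of_int j * \<xi>)))\<^sup>2) has_integral
       2 * pi - 2 * (\<Sum>j\<in>A. s j * (2 * pi * s j)) + 2 * pi * (\<Sum>j\<in>A. (s j)\<^sup>2)) {-pi..pi}"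
    unfolding s_def
    by (intro has_integral_add has_integral_diff one has_integral_mult_right has_integral_sum assms
          has_integral_cos_sinc has_integral_norm_trig_polynomial)
  also have "2 * pi - 2 * (\<Sum>j\<in>A. s j * (2 * pi * s j)) + 2 * pi * (\<Sum>j\<in>A. (s j)\<^sup>2)
     = 2 * pi * (1 - (\<Sum>j\<in>A. (s j)\<^sup>2))"
    by (simp add: sum_distrib_left power2_eq_square algebra_simps)
  finally show ?thesis unfolding expand[symmetric] unfolding s_def .
qed

lemma sum_lessThan_double:
  fixes f :: "nat \<Rightarrow> real"
  shows "(\<Sum>i<N + N. f i) = (\<Sum>i<N. f i) + (\<Sum>i<N. f (i + N))"
proof -
  have "(\<Sum>i<N + N. f i) = (\<Sum>i=0..<N. f i) + (\<Sum>i=0 + N..<N + N. f i)"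
    by (simp add: lessThan_atLeast0 sum.atLeastLessThan_concat)
  then show ?thesis by (simp only: sum.shift_bounds_nat_ivl lessThan_atLeast0)
qed

text \<open>A finite form of the partial fraction expansion of \<open>1 / (sin (pi t))\<^sup>2\<close>, obtained by iterating
\<open>1 / (sin (2 y))\<^sup>2 = (1 / (sin y)\<^sup>2 + 1 / (sin (y + pi / 2))\<^sup>2) / 4\<close>.\<close>

lemma cosecant_square_sum:
  assumes "0 < t" "t < (1::real)"
  shows "(\<Sum>i<2^k. 1 / (sin (pi * (t + real i) / 2^k))\<^sup>2) = 4^k / (sin (pi * t))\<^sup>2"
proof (induction k)
  case 0
  then show ?case by simp
next
  case (Suc k)
  let ?f = "\<lambda>i. 1 / (sin (pi * (t + real i) / 2^Suc k))\<^sup>2"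
  have "(\<Sum>i<2^Suc k. ?f i) = (\<Sum>i<2^k. ?f i) + (\<Sum>i<2^k. ?f (i + 2^k))"
    by (simp only: power_Suc mult_2 sum_lessThan_double)
  also have "\<dots> = (\<Sum>i<2^k. ?f i + ?f (i + 2^k))" by (simp add: sum.distrib)
  also have "\<dots> = (\<Sum>i<2^k. 4 * (1 / (sin (pi * (t + real i) / 2^k))\<^sup>2))"
  proof (rule sum.cong[OF refl])
    fix i :: nat assume "i \<in> {..<2^k}"
    then have "real (i + 1) \<le> real (2^k)" by (subst of_nat_le_iff) auto
    define y where "y = pi * (t + real i) / 2^Suc k"
    have lt: "t + real i < 2^k" using \<open>real (i + 1) \<le> real (2^k)\<close> assms by simp
    have "0 < y" unfolding y_def using assms by (auto intro!: divide_pos_pos mult_pos_pos add_pos_nonneg)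
    moreover have "y < pi / 2"
      using mult_strict_left_mono[OF lt pi_gt_zero] by (simp add: y_def divide_simps mult_ac)
    ultimately have s: "sin y > 0" and c: "cos y > 0" by (auto intro!: sin_gt_zero cos_gt_zero)
    have "pi * (t + real (i + 2^k)) / 2^Suc k = y + pi / 2" by (simp add: y_def field_simps)
    then have "?f i + ?f (i + 2^k) = 1 / (sin y)\<^sup>2 + 1 / (cos y)\<^sup>2"
      by (simp only: y_def[symmetric]) (simp add: sin_add)
    also have "\<dots> = ((cos y)\<^sup>2 + (sin y)\<^sup>2) / ((sin y)\<^sup>2 * (cos y)\<^sup>2)"
      using s c by (simp add: field_simps)
    also have "\<dots> = 4 * (1 / (sin (2 * y))\<^sup>2)"
      unfolding sin_double by (simp add: power_mult_distrib)
    also have "2 * y = pi * (t + real i) / 2^k" by (simp add: y_def)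
    finally show "?f i + ?f (i + 2^k) = 4 * (1 / (sin (pi * (t + real i) / 2^k))\<^sup>2)" .
  qed
  also have "\<dots> = 4 * (4^k / (sin (pi * t))\<^sup>2)" unfolding sum_distrib_left[symmetric] Suc ..
  finally show ?case by simp
qed

text \<open>This is \<open>cot\<^sup>2 y \<le> 1 / y\<^sup>2\<close> in disguise, that is \<open>y \<le> tan y\<close> for \<open>0 < y < pi / 2\<close>.\<close>

lemma cosecant_square_le:
  fixes y :: real assumes "\<bar>y\<bar> < pi / 2" shows "1 / (sin y)\<^sup>2 \<le> 1 + 1 / y\<^sup>2"
proof -
  have *: "1 / (sin y)\<^sup>2 \<le> 1 + 1 / y\<^sup>2" if "0 < y" "y < pi / 2" for y :: real
  proof -
    have s: "sin y > 0" and c: "cos y > 0" using that by (auto intro!: sin_gt_zero cos_gt_zero)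
    have "sin 0 - 0 * cos 0 \<le> sin y - y * cos y"
    proof (rule DERIV_nonneg_imp_nondecreasing[where f="\<lambda>x. sin x - x * cos x"])
      show "0 \<le> y" using that by simp
      fix x assume "0 \<le> x" "x \<le> y"
      then have "0 \<le> x * sin x" using that by (intro mult_nonneg_nonneg sin_ge_zero) auto
      moreover have "((\<lambda>x. sin x - x * cos x) has_real_derivative x * sin x) (at x)"
        by (auto intro!: derivative_eq_intros)
      ultimately show "\<exists>d. ((\<lambda>x. sin x - x * cos x) has_real_derivative d) (at x) \<and> 0 \<le> d" by blast
    qed
    then have "y * cos y \<le> sin y" by simp
    then have "(y * cos y)\<^sup>2 \<le> (sin y)\<^sup>2" using that c by (intro power_mono) auto
    then have "(cos y)\<^sup>2 / (sin y)\<^sup>2 \<le> 1 / y\<^sup>2" using s that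
      by (simp add: field_simps power_mult_distrib)
    moreover have "1 / (sin y)\<^sup>2 = 1 + (cos y)\<^sup>2 / (sin y)\<^sup>2"
      using s by (simp add: field_simps)
    ultimately show ?thesis by simp
  qed
  show ?thesis
    using *[of y] *[of "-y"] assms by (cases y "0::real" rule: linorder_cases) auto
qed

lemma finite_J [simp]: "finite (J n)" by (simp add: J_def)

text \<open>In \<open>cosecant_square_sum\<close> with \<open>N = 2 * 2^k\<close> terms, shifting half of the arguments by a period moves the
points \<open>t + i\<close> to \<open>t - j\<close> with \<open>j \<in> J (2^k)\<close>, all of modulus less than \<open>N / 2\<close>. There \<open>cosecant_square_le\<close>
replaces each term by \<open>(N / (pi (t - j)))\<^sup>2\<close> at a cost of \<open>1\<close>, hence at a total cost of \<open>N\<close> against a left-hand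
side of order \<open>N\<^sup>2\<close>.\<close>

lemma sinc_square_sum_ge:
  assumes "0 \<le> t" "t \<le> (1::real)"
  shows "1 - 1 / 2^k \<le> (\<Sum>j\<in>J (2^k). (sinc (pi * (t - real_of_int j)))\<^sup>2)"
proof (cases "t = 0 \<or> t = 1")
  case True
  then obtain i where i: "i \<in> J (2^k)" "t = real_of_int i"
    by (auto simp: J_def intro: that[of 0] that[of 1])
  have "1 = (sinc (pi * (t - real_of_int i)))\<^sup>2" using i by simp
  also have "\<dots> \<le> (\<Sum>j\<in>J (2^k). (sinc (pi * (t - real_of_int j)))\<^sup>2)"
    by (rule member_le_sum[OF i(1)]) auto
  finally show ?thesis by (smt (verit) zero_le_divide_1_iff zero_le_power)
next
  case False
  then have t: "0 < t" "t < 1" using assms by auto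
  define M :: nat where "M = 2^k"
  have Mpos: "real M > 0" by (simp add: M_def)
  have s: "sin (pi * t) > 0" using t by (intro sin_gt_zero) auto
  define h where "h x = 1 + (2 * real M)\<^sup>2 / (pi\<^sup>2 * x\<^sup>2)" for x
  have h: "1 / (sin (pi * x / (2 * real M)))\<^sup>2 \<le> h x" if "\<bar>x\<bar> < real M" for x
  proof -
    have "\<bar>pi * x / (2 * real M)\<bar> < pi / 2" using that Mpos by (simp add: abs_mult field_simps)
    from cosecant_square_le[OF this] show ?thesis by (simp add: h_def power_mult_distrib power_divide)
  qed
  have split: "{..<2^Suc k} = {..<M} \<union> {M..<2*M}" by (auto simp: M_def)
  have "4 * (real M)\<^sup>2 / (sin (pi * t))\<^sup>2 = 4^Suc k / (sin (pi * t))\<^sup>2"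
    by (simp add: M_def power2_eq_square flip: power_mult_distrib)
  also have "\<dots> = (\<Sum>i<2^Suc k. 1 / (sin (pi * (t + real i) / (2 * real M)))\<^sup>2)"
    using cosecant_square_sum[OF t, of "Suc k"] by (simp add: M_def)
  also have "\<dots> = (\<Sum>i<M. 1 / (sin (pi * (t + real i) / (2 * real M)))\<^sup>2)
     + (\<Sum>i=M..<2*M. 1 / (sin (pi * (t + real i) / (2 * real M)))\<^sup>2)"
    unfolding split by (rule sum.union_disjoint) auto
  also have "\<dots> \<le> (\<Sum>i<M. h (t + real i)) + (\<Sum>i=M..<2*M. h (t + real i - 2 * real M))"
  proof (intro add_mono sum_mono)
    fix i assume "i \<in> {..<M}"
    then have "i + 1 \<le> M" by simp
    then have "real i + 1 \<le> real M" by linarith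
    then show "1 / (sin (pi * (t + real i) / (2 * real M)))\<^sup>2 \<le> h (t + real i)"
      using t by (intro h) auto
  next
    fix i assume i: "i \<in> {M..<2*M}"
    then have "i + 1 \<le> 2 * M" "M \<le> i" by auto
    then have "real i + 1 \<le> 2 * real M" "real M \<le> real i" by linarith+
    then have "1 / (sin (pi * (t + real i - 2 * real M) / (2 * real M)))\<^sup>2 \<le> h (t + real i - 2 * real M)"
      using t by (intro h) auto
    moreover have "pi * (t + real i) / (2 * real M) = pi * (t + real i - 2 * real M) / (2 * real M) + pi"
      using Mpos by (simp add: field_simps)
    ultimately show "1 / (sin (pi * (t + real i) / (2 * real M)))\<^sup>2 \<le> h (t + real i - 2 * real M)"
      by (simp only: sin_periodic_pi power2_minus)
  qed
  also have "(\<Sum>i<M. h (t + real i)) = (\<Sum>j\<in>{- int M + 1..0}. h (t - real_of_int j))"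
    by (rule sum.reindex_bij_witness[where j="\<lambda>i. - int i" and i="\<lambda>j. nat (-j)"]) auto
  also have "(\<Sum>i=M..<2*M. h (t + real i - 2 * real M)) = (\<Sum>j\<in>{1..int M}. h (t - real_of_int j))"
    by (rule sum.reindex_bij_witness[where j="\<lambda>i. int (2 * M) - int i" and i="\<lambda>j. nat (int (2 * M) - j)"])
       (auto simp: algebra_simps)
  also have "(\<Sum>j\<in>{- int M + 1..0}. h (t - real_of_int j)) + (\<Sum>j\<in>{1..int M}. h (t - real_of_int j))
     = (\<Sum>j\<in>J M. h (t - real_of_int j))"
    unfolding J_def by (subst sum.union_disjoint[symmetric]) (auto intro!: sum.cong simp: M_def)
  also have "\<dots> = 2 * real M + (\<Sum>j\<in>J M. (2 * real M)\<^sup>2 / (pi\<^sup>2 * (t - real_of_int j)\<^sup>2))"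
    by (simp add: h_def sum.distrib J_def)
  also have "(\<Sum>j\<in>J M. (2 * real M)\<^sup>2 / (pi\<^sup>2 * (t - real_of_int j)\<^sup>2))
     = 4 * (real M)\<^sup>2 / (sin (pi * t))\<^sup>2 * (\<Sum>j\<in>J M. (sinc (pi * (t - real_of_int j)))\<^sup>2)"
    unfolding sum_distrib_left
  proof (rule sum.cong[OF refl])
    fix j :: int
    have "t \<noteq> real_of_int j"
    proof
      assume "t = real_of_int j"
      with t have "0 < j" "j < 1" by simp_all
      then show False by simp
    qed
    moreover have "(sin (pi * (t - real_of_int j)))\<^sup>2 = (sin (pi * t))\<^sup>2"
    proof -
      have "sin (real_of_int j * pi) = 0" by (simp add: sin_zero_iff_int2)
      then have "(cos (real_of_int j * pi))\<^sup>2 = 1" by (simp add: cos_squared_eq)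
      then show ?thesis using \<open>sin (real_of_int j * pi) = 0\<close>
        by (simp add: right_diff_distrib sin_diff mult.commute power_mult_distrib)
    qed
    ultimately show "(2 * real M)\<^sup>2 / (pi\<^sup>2 * (t - real_of_int j)\<^sup>2) =
      4 * (real M)\<^sup>2 / (sin (pi * t))\<^sup>2 * (sinc (pi * (t - real_of_int j)))\<^sup>2"
      using s by (simp add: power_mult_distrib power_divide)
  qed
  finally have *: "4 * (real M)\<^sup>2 / (sin (pi * t))\<^sup>2 \<le> 2 * real M + 4 * (real M)\<^sup>2 / (sin (pi * t))\<^sup>2 *
     (\<Sum>j\<in>J M. (sinc (pi * (t - real_of_int j)))\<^sup>2)" .
  define S where "S = (\<Sum>j\<in>J M. (sinc (pi * (t - real_of_int j)))\<^sup>2)"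
  define q where "q = (sin (pi * t))\<^sup>2"
  have q: "0 < q" "q \<le> 1" using s by (auto simp: q_def abs_square_le_1)
  have "4 * (real M)\<^sup>2 \<le> 2 * real M * q + 4 * (real M)\<^sup>2 * S"
    using * q(1) unfolding S_def[symmetric] q_def[symmetric] by (simp add: field_simps)
  also have "\<dots> \<le> 2 * real M * 1 + 4 * (real M)\<^sup>2 * S" using q Mpos by simp
  finally have "real M * (4 * real M) \<le> real M * (2 + 4 * real M * S)"
    by (simp add: power2_eq_square algebra_simps)
  then have "4 * real M \<le> 2 + 4 * real M * S" using Mpos by simp
  then have "1 - 1 / real M \<le> S" using Mpos by (simp add: field_simps)
  then show ?thesis by (simp add: S_def M_def)
qed

section \<open>Windowed sampling series\<close>

definition windowed_series :: "(real \<Rightarrow> complex) \<Rightarrow> real \<Rightarrow> int set \<Rightarrow> real \<Rightarrow> complex" where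
  "windowed_series \<phi> t A \<xi> =
    (\<Sum>j\<in>A. \<phi> (t - real_of_int j) * of_real (sinc (pi * (t - real_of_int j))) * cis (real_of_int j * \<xi>))"

definition series_error :: "(real \<Rightarrow> complex) \<Rightarrow> real \<Rightarrow> nat \<Rightarrow> real \<Rightarrow> real" where
  "series_error \<phi> t k \<xi> = (norm (\<phi> 0 * cis (t * \<xi>) - windowed_series \<phi> t (J (2^k)) \<xi>))\<^sup>2"

text \<open>The windowed sampling series of \<open>exp (\<i> t \<xi>)\<close> converges to \<open>\<phi> 0 * exp (\<i> t \<xi>)\<close> in \<open>L\<^sup>2\<close> on \<open>[-(pi - b), pi - b]\<close>.
Only the truncations to \<open>J (2^k)\<close> are considered because \<open>sinc_square_sum_ge\<close> is about these. No
value is prescribed for \<open>\<phi> 0\<close>, so that the property is linear in \<open>\<phi>\<close>.\<close>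

definition reproduces :: "real \<Rightarrow> real \<Rightarrow> (real \<Rightarrow> complex) \<Rightarrow> bool" where
  "reproduces t b \<phi> \<longleftrightarrow> (\<lambda>k. integral {-(pi - b)..pi - b} (series_error \<phi> t k)) \<longlonglongrightarrow> 0"

lemma continuous_on_windowed_series [continuous_intros]: "continuous_on S (windowed_series \<phi> t A)"
  unfolding windowed_series_def by (intro continuous_intros)

lemma continuous_on_series_error: "continuous_on S (series_error \<phi> t k)"
  unfolding series_error_def by (intro continuous_intros)

lemma series_error_integrable: "series_error \<phi> t k integrable_on {a..b}"
  by (intro integrable_continuous_interval continuous_on_series_error)

lemma series_error_nonneg [simp]: "0 \<le> series_error \<phi> t k \<xi>"
  by (simp add: series_error_def)

lemma reproduces_squeeze:
  assumes "\<And>k. integral {-(pi - b)..pi - b} (series_error \<phi> t k) \<le> g k" and "g \<longlonglongrightarrow> 0"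
  shows "reproduces t b \<phi>"
  unfolding reproduces_def
  by (rule tendsto_sandwich[OF _ _ tendsto_const assms(2)])
     (use assms(1) in \<open>auto intro!: always_eventually integral_nonneg series_error_integrable\<close>)

lemma reproduces_const_one:
  assumes "0 \<le> t" "t \<le> 1"
  shows "reproduces t 0 (\<lambda>_. 1)"
proof (rule reproduces_squeeze)
  fix k
  have "integral {-(pi - 0)..pi - 0} (series_error (\<lambda>_. 1) t k)
     = 2 * pi * (1 - (\<Sum>j\<in>J (2^k). (sinc (pi * (t - real_of_int j)))\<^sup>2))"
    using integral_unique[OF has_integral_fourier_error[OF finite_J, of t "2^k"]]
    by (simp add: series_error_def[abs_def] windowed_series_def)
  also have "\<dots> \<le> 2 * pi * (1 / 2) ^ k"
    using sinc_square_sum_ge[OF assms, of k] by (intro mult_left_mono) (simp_all add: power_one_over)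
  finally show "integral {-(pi - 0)..pi - 0} (series_error (\<lambda>_. 1) t k) \<le> 2 * pi * (1 / 2) ^ k" .
next
  show "(\<lambda>k. 2 * pi * (1 / 2 :: real) ^ k) \<longlonglongrightarrow> 0"
    by (intro tendsto_mult_right_zero LIMSEQ_power_zero) simp
qed

lemma reproduces_mono:
  assumes "reproduces t b \<phi>" "b \<le> b'"
  shows "reproduces t b' \<phi>"
proof (rule reproduces_squeeze[OF _ assms(1)[unfolded reproduces_def]])
  fix k
  show "integral {-(pi - b')..pi - b'} (series_error \<phi> t k)
     \<le> integral {-(pi - b)..pi - b} (series_error \<phi> t k)"
    using assms(2) by (intro integral_subset_le series_error_integrable) auto
qed

lemma norm_add_square_le: "(norm (u + v :: 'a::real_normed_vector))\<^sup>2 \<le> 2 * (norm u)\<^sup>2 + 2 * (norm v)\<^sup>2"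
proof -
  have "(norm (u + v))\<^sup>2 \<le> (norm u + norm v)\<^sup>2" by (intro power_mono norm_triangle_ineq) auto
  also have "\<dots> \<le> 2 * (norm u)\<^sup>2 + 2 * (norm v)\<^sup>2"
    using sum_squares_bound[of "norm u" "norm v"] by (simp add: power2_sum)
  finally show ?thesis .
qed

lemma reproduces_linear:
  assumes "reproduces t b \<phi>" "reproduces t b \<psi>"
  shows "reproduces t b (\<lambda>x. c * \<phi> x + d * \<psi> x)"
proof (rule reproduces_squeeze)
  fix k
  let ?I = "{-(pi - b)..pi - b}"
  have "series_error (\<lambda>x. c * \<phi> x + d * \<psi> x) t k \<xi>
     \<le> 2 * (norm c)\<^sup>2 * series_error \<phi> t k \<xi> + 2 * (norm d)\<^sup>2 * series_error \<psi> t k \<xi>" for \<xi>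
  proof -
    let ?e = "\<lambda>\<phi>. \<phi> 0 * cis (t * \<xi>) - windowed_series \<phi> t (J (2^k)) \<xi>"
    have "?e (\<lambda>x. c * \<phi> x + d * \<psi> x) = c * ?e \<phi> + d * ?e \<psi>"
      by (simp add: windowed_series_def sum_distrib_left sum.distrib algebra_simps)
    then show ?thesis using norm_add_square_le[of "c * ?e \<phi>" "d * ?e \<psi>"]
      by (simp add: series_error_def norm_mult power_mult_distrib mult_ac)
  qed
  then have "integral ?I (series_error (\<lambda>x. c * \<phi> x + d * \<psi> x) t k) \<le>
     integral ?I (\<lambda>\<xi>. 2 * (norm c)\<^sup>2 * series_error \<phi> t k \<xi> + 2 * (norm d)\<^sup>2 * series_error \<psi> t k \<xi>)"
    by (intro integral_le series_error_integrable integrable_add integrable_on_mult_right)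
  also have "\<dots> = 2 * (norm c)\<^sup>2 * integral ?I (series_error \<phi> t k)
     + 2 * (norm d)\<^sup>2 * integral ?I (series_error \<psi> t k)"
    by (subst integral_add) (auto intro!: series_error_integrable integrable_on_mult_right)
  finally show "integral ?I (series_error (\<lambda>x. c * \<phi> x + d * \<psi> x) t k) \<le> \<dots>" .
next
  show "(\<lambda>k. 2 * (norm c)\<^sup>2 * integral {-(pi - b)..pi - b} (series_error \<phi> t k)
     + 2 * (norm d)\<^sup>2 * integral {-(pi - b)..pi - b} (series_error \<psi> t k)) \<longlonglongrightarrow> 0"
    using assms unfolding reproduces_def
    by (intro tendsto_add_zero tendsto_mult_right_zero)
qed

text \<open>A factor \<open>exp (\<i> \<theta> (t - j))\<close> in the coefficients amounts to evaluating the series at \<open>\<xi> - \<theta>\<close>, which stays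
in the interval of convergence if \<open>\<xi>\<close> is at a distance of at least \<open>\<bar>\<theta>\<bar>\<close> from its ends.\<close>

lemma reproduces_modulate:
  assumes "reproduces t b \<phi>"
  shows "reproduces t (b + \<bar>\<theta>\<bar>) (\<lambda>x. cis (\<theta> * x) * \<phi> x)"
proof (rule reproduces_squeeze[OF _ assms(1)[unfolded reproduces_def]])
  fix k
  have shift: "series_error (\<lambda>x. cis (\<theta> * x) * \<phi> x) t k \<xi> = series_error \<phi> t k (- \<theta> + \<xi>)" for \<xi>
  proof -
    have split: "cis (\<theta> * (t - y)) * w * cis (y * \<xi>) = cis (\<theta> * t) * (w * cis (y * (\<xi> - \<theta>)))" for y w
    proof -
      have "cis (\<theta> * (t - y)) * cis (y * \<xi>) = cis (\<theta> * t) * cis (y * (\<xi> - \<theta>))"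
        by (simp add: cis_mult algebra_simps)
      then show ?thesis by (metis mult.assoc mult.commute)
    qed
    have series: "windowed_series (\<lambda>x. cis (\<theta> * x) * \<phi> x) t A \<xi>
      = cis (\<theta> * t) * windowed_series \<phi> t A (\<xi> - \<theta>)" for A
      unfolding windowed_series_def sum_distrib_left
    proof (rule sum.cong[OF refl])
      fix j :: int
      let ?w = "\<phi> (t - real_of_int j) * of_real (sinc (pi * (t - real_of_int j)))"
      show "cis (\<theta> * (t - real_of_int j)) * \<phi> (t - real_of_int j) * of_real (sinc (pi * (t - real_of_int j)))
          * cis (real_of_int j * \<xi>) = cis (\<theta> * t) * (?w * cis (real_of_int j * (\<xi> - \<theta>)))"
        using split[of "real_of_int j" ?w] by (simp only: mult.assoc)
    qed
    have "\<phi> 0 * cis (t * \<xi>) = cis (\<theta> * t) * (\<phi> 0 * cis (t * (\<xi> - \<theta>)))"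
      using split[of t "\<phi> 0"] by simp
    then have "(\<lambda>x. cis (\<theta> * x) * \<phi> x) 0 * cis (t * \<xi>) - windowed_series (\<lambda>x. cis (\<theta> * x) * \<phi> x) t (J (2^k)) \<xi>
      = cis (\<theta> * t) * (\<phi> 0 * cis (t * (\<xi> - \<theta>)) - windowed_series \<phi> t (J (2^k)) (\<xi> - \<theta>))"
      by (simp add: series right_diff_distrib)
    then show ?thesis by (simp add: series_error_def norm_mult)
  qed
  have "integral {-(pi - (b + \<bar>\<theta>\<bar>))..pi - (b + \<bar>\<theta>\<bar>)} (series_error (\<lambda>x. cis (\<theta> * x) * \<phi> x) t k)
     = integral {-(pi - (b + \<bar>\<theta>\<bar>)) + (- \<theta>)..pi - (b + \<bar>\<theta>\<bar>) + (- \<theta>)} (series_error \<phi> t k)"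
    by (simp only: integral_shift_Icc_real[symmetric] o_def shift[symmetric])
  also have "\<dots> \<le> integral {-(pi - b)..pi - b} (series_error \<phi> t k)"
    by (intro integral_subset_le series_error_integrable) auto
  finally show "integral {-(pi - (b + \<bar>\<theta>\<bar>))..pi - (b + \<bar>\<theta>\<bar>)} (series_error (\<lambda>x. cis (\<theta> * x) * \<phi> x) t k)
     \<le> integral {-(pi - b)..pi - b} (series_error \<phi> t k)" .
qed

lemma reproduces_cos_mult:
  assumes "reproduces t b \<phi>" "0 \<le> \<theta>"
  shows "reproduces t (b + \<theta>) (\<lambda>x. of_real (cos (\<theta> * x)) * \<phi> x)"
proof -
  have "reproduces t (b + \<theta>) (\<lambda>x. 1/2 * (cis (\<theta> * x) * \<phi> x) + 1/2 * (cis (- \<theta> * x) * \<phi> x))"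
    using reproduces_modulate[OF assms(1), of \<theta>] reproduces_modulate[OF assms(1), of "-\<theta>"] assms(2)
    by (intro reproduces_linear) simp_all
  moreover have "1/2 * (cis (\<theta> * x) * \<phi> x) + 1/2 * (cis (- \<theta> * x) * \<phi> x)
     = of_real (cos (\<theta> * x)) * \<phi> x" for x
  proof -
    have "cis (\<theta> * x) + cis (- \<theta> * x) = 2 * of_real (cos (\<theta> * x))" by (simp add: complex_eq_iff)
    then show ?thesis by (simp flip: distrib_left distrib_right add: field_simps)
  qed
  ultimately show ?thesis by simp
qed

section \<open>The Chebyshev window\<close>

fun chebyshev :: "nat \<Rightarrow> real \<Rightarrow> real" where
  "chebyshev 0 y = 1"
| "chebyshev (Suc 0) y = y"
| "chebyshev (Suc (Suc m)) y = 2 * y * chebyshev (Suc m) y - chebyshev m y"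

lemma chebyshev_cos: "chebyshev m (cos u) = cos (real m * u)"
proof (induction m "cos u" rule: chebyshev.induct)
  case (3 m)
  have "real (Suc (Suc m)) * u = real (Suc m) * u + u" "real m * u = real (Suc m) * u - u"
    by (simp_all add: algebra_simps)
  then show ?case unfolding chebyshev.simps 3 by (simp only: cos_add cos_diff) (simp add: algebra_simps)
qed auto

lemma chebyshev_cosh: "chebyshev m (cosh u) = cosh (real m * u)"
proof (induction m "cosh u" rule: chebyshev.induct)
  case (3 m)
  have "real (Suc (Suc m)) * u = real (Suc m) * u + u" "real m * u = real (Suc m) * u - u"
    by (simp_all add: algebra_simps)
  then show ?case unfolding chebyshev.simps 3 by (simp only: cosh_add cosh_diff) (simp add: algebra_simps)
qed auto

lemma chebyshev_minus: "chebyshev m (- y) = (-1)^m * chebyshev m y"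
  by (induction m y rule: chebyshev.induct) (simp_all add: algebra_simps)

lemma abs_chebyshev_le_1: "\<bar>y\<bar> \<le> 1 \<Longrightarrow> \<bar>chebyshev m y\<bar> \<le> 1"
  using chebyshev_cos[of m "arccos y"] by (simp add: cos_arccos_abs)

text \<open>Beyond \<open>[-1, 1]\<close> the Chebyshev polynomials are \<open>\<plusminus> cosh (m * arcosh \<bar>y\<bar>)\<close>, which increases with \<open>\<bar>y\<bar>\<close>.\<close>

lemma abs_chebyshev_le:
  assumes "\<bar>y\<bar> \<le> z" "1 \<le> z"
  shows "\<bar>chebyshev m y\<bar> \<le> chebyshev m z"
proof -
  have z: "cosh (arcosh z) = z" "0 \<le> arcosh z" using assms by (simp_all add: arcosh_nonneg_real)
  have pos: "1 \<le> chebyshev m z" using chebyshev_cosh[of m "arcosh z"] z by (simp add: cosh_real_ge_1)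
  have *: "\<bar>chebyshev m x\<bar> \<le> chebyshev m z" if "1 \<le> x" "x \<le> z" for x
  proof -
    have x: "cosh (arcosh x) = x" "0 \<le> arcosh x" using that by (simp_all add: arcosh_nonneg_real)
    have "arcosh x \<le> arcosh z" using that x z by (metis cosh_real_nonneg_le_iff)
    then have "real m * arcosh x \<le> real m * arcosh z" by (simp add: mult_left_mono)
    then have "cosh (real m * arcosh x) \<le> cosh (real m * arcosh z)"
      using x z by (subst cosh_real_nonneg_le_iff) auto
    then show ?thesis using chebyshev_cosh[of m "arcosh x"] chebyshev_cosh[of m "arcosh z"] x z
      by (simp add: abs_of_nonneg)
  qed
  consider "\<bar>y\<bar> \<le> 1" | "1 \<le> y" | "1 \<le> - y" by linarith
  then show ?thesis
  proof cases
    case 1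
    then show ?thesis using abs_chebyshev_le_1[of y m] pos by simp
  next
    case 2
    then show ?thesis using * assms by simp
  next
    case 3
    then show ?thesis using *[of "-y"] assms by (simp add: chebyshev_minus abs_mult)
  qed
qed

text \<open>Each step of the recurrence multiplies by \<open>cos (\<theta> x)\<close> once and so shrinks the interval of
convergence by \<open>\<theta>\<close> at either end.\<close>

lemma reproduces_chebyshev:
  assumes "0 \<le> t" "t \<le> 1" "0 \<le> \<theta>"
  shows "reproduces t (real m * \<theta>) (\<lambda>x. of_real (chebyshev m (c * cos (\<theta> * x))))"
proof (induction m rule: induct_nat_012)
  case 0
  then show ?case using reproduces_const_one[OF assms(1,2)] by simp
next
  case 1
  have "reproduces t (0 + \<theta>) (\<lambda>x. of_real c * (of_real (cos (\<theta> * x)) * 1) + 0 * (of_real (cos (\<theta> * x)) * 1))"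
    by (intro reproduces_linear reproduces_cos_mult reproduces_const_one assms)
  then show ?case by simp
next
  case (ge2 m)
  have "reproduces t (real (Suc m) * \<theta> + \<theta>)
     (\<lambda>x. (2 * of_real c) * (of_real (cos (\<theta> * x)) * of_real (chebyshev (Suc m) (c * cos (\<theta> * x))))
        + (-1) * of_real (chebyshev m (c * cos (\<theta> * x))))"
    using assms ge2
    by (intro reproduces_linear reproduces_cos_mult reproduces_mono[OF ge2(1)])
       (auto simp: algebra_simps)
  moreover have "real (Suc m) * \<theta> + \<theta> = real (Suc (Suc m)) * \<theta>" by (simp add: algebra_simps)
  ultimately show ?case by (simp add: mult_ac)
qed

lemma continuous_on_chebyshev [continuous_intros]:
  "continuous_on S f \<Longrightarrow> continuous_on S (\<lambda>x. chebyshev m (f x))"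
  by (induction m rule: induct_nat_012) (auto intro!: continuous_intros)

text \<open>The derivative \<open>cos x sinh x - sin x cosh x\<close> vanishes at \<open>0\<close>, and its own derivative is
\<open>- 2 sin x sinh x \<le> 0\<close>.\<close>

lemma cos_cosh_le_1:
  assumes "0 \<le> x" "x \<le> pi / 2" shows "cos x * cosh x \<le> (1::real)"
proof -
  have "cos x * cosh x \<le> cos 0 * cosh (0::real)"
  proof (rule DERIV_nonpos_imp_nonincreasing[where f="\<lambda>x. cos x * cosh x"])
    show "0 \<le> x" by fact
    fix y assume y: "0 \<le> y" "y \<le> x"
    have "(\<lambda>x. cos x * sinh x - sin x * cosh x) y \<le> (\<lambda>x. cos x * sinh x - sin x * cosh x) 0"
    proof (rule DERIV_nonpos_imp_nonincreasing[where f="\<lambda>x. cos x * sinh x - sin x * cosh x"])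
      show "0 \<le> y" by fact
      fix z assume "0 \<le> z" "z \<le> y"
      then have "0 \<le> sin z * sinh z"
        using y assms by (intro mult_nonneg_nonneg sin_ge_zero) auto
      moreover have "((\<lambda>x. cos x * sinh x - sin x * cosh x) has_real_derivative - 2 * (sin z * sinh z)) (at z)"
        by (auto intro!: derivative_eq_intros)
      ultimately show "\<exists>d. ((\<lambda>x. cos x * sinh x - sin x * cosh x) has_real_derivative d) (at z) \<and> d \<le> 0"
        by (intro exI conjI) auto
    qed
    moreover have "((\<lambda>x. cos x * cosh x) has_real_derivative cos y * sinh y - sin y * cosh y) (at y)"
      by (auto intro!: derivative_eq_intros)
    ultimately show "\<exists>d. ((\<lambda>x. cos x * cosh x) has_real_derivative d) (at y) \<and> d \<le> 0"
      by (intro exI conjI) auto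
  qed
  then show ?thesis by simp
qed

text \<open>Normalising the window divides by \<open>chebyshev m (1 / cos x)\<close> with \<open>x = \<theta> n\<close>; as \<open>1 / cos x \<ge> cosh x\<close>,
this is at least \<open>cosh (m x) = cosh (a n)\<close>, where the exponential gain comes from.\<close>

lemma cosh_le_chebyshev_sec:
  assumes "0 \<le> x" "x < pi / 2" shows "cosh (real m * x) \<le> chebyshev m (1 / cos x)"
proof -
  have c: "cos x > 0" using assms by (intro cos_gt_zero_pi) auto
  have "cosh x \<le> 1 / cos x" using cos_cosh_le_1[of x] assms c by (simp add: field_simps)
  then have "chebyshev m (cosh x) \<le> chebyshev m (1 / cos x)"
    using abs_chebyshev_le[of "cosh x" "1 / cos x" m] cosh_real_ge_1[of x] by (simp add: abs_le_iff)
  then show ?thesis by (simp add: chebyshev_cosh)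
qed

lemma abs_cos_le_cos:
  assumes "0 \<le> a" "a \<le> \<bar>y\<bar>" "\<bar>y\<bar> \<le> pi - a"
  shows "\<bar>cos y\<bar> \<le> cos (a::real)"
proof -
  have "cos \<bar>y\<bar> \<le> cos a" using assms by (intro cos_monotone_0_pi_le) auto
  moreover have "cos (pi - a) \<le> cos \<bar>y\<bar>" using assms by (intro cos_monotone_0_pi_le) auto
  ultimately show ?thesis by (simp add: abs_le_iff cos_diff)
qed

text \<open>A window that is small for \<open>n \<le> \<bar>x\<bar> \<le> R\<close>, where \<open>R\<close> can be prescribed at will. The degree has to be chosen
so large that \<open>\<theta> * (R + n) < pi\<close>: on this range \<open>\<bar>cos (\<theta> x)\<bar> \<le> cos (\<theta> n)\<close>, and the argument of the
Chebyshev polynomial lies in \<open>[-1, 1]\<close>.\<close>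

lemma chebyshev_window:
  fixes n R :: nat and a :: real
  assumes "0 \<le> a" "n \<le> R"
  obtains \<phi> :: "real \<Rightarrow> real" where "continuous_on UNIV \<phi>" "\<phi> 0 = 1" "\<And>x. \<bar>\<phi> x\<bar> \<le> 1"
    "\<And>x. real n \<le> \<bar>x\<bar> \<Longrightarrow> \<bar>x\<bar> \<le> real R \<Longrightarrow> \<bar>\<phi> x\<bar> \<le> 2 * exp (- a * real n)"
    "\<And>t. 0 \<le> t \<Longrightarrow> t \<le> 1 \<Longrightarrow> reproduces t a (\<lambda>x. of_real (\<phi> x))"
proof -
  \<comment> \<open>The summand 1 makes the inequality strict, also for \<open>a = 0\<close>.\<close>
  obtain m :: nat where m: "a * (real R + real n + 1) / pi < real m" using reals_Archimedean2 by blast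
  have "0 \<le> a * (real R + real n + 1) / pi" using assms by simp
  with m have mpos: "real m > 0" by linarith
  define \<theta> where "\<theta> = a / real m"
  have \<theta>: "0 \<le> \<theta>" "real m * \<theta> = a" using mpos assms by (auto simp: \<theta>_def)
  have le: "\<theta> * (real R + real n + 1) < pi" using m mpos by (simp add: \<theta>_def field_simps)
  have nR: "\<theta> * real n \<le> \<theta> * real R" using assms \<theta> by (intro mult_left_mono) auto
  have small: "0 \<le> \<theta> * real n" "\<theta> * real n < pi / 2" using le nR \<theta> by (auto simp: algebra_simps)
  define s where "s = 1 / cos (\<theta> * real n)"
  have c: "cos (\<theta> * real n) > 0" using small by (intro cos_gt_zero_pi) auto
  then have s: "1 \<le> s" "s > 0" by (auto simp: s_def field_simps)
  have big: "exp (a * real n) / 2 \<le> chebyshev m s"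
  proof -
    have "exp (a * real n) / 2 \<le> cosh (a * real n)" by (simp add: cosh_def)
    also have "\<dots> = cosh (real m * (\<theta> * real n))" unfolding mult.assoc[symmetric] \<theta>(2) ..
    also have "\<dots> \<le> chebyshev m s"
      unfolding s_def by (rule cosh_le_chebyshev_sec[OF small])
    finally show ?thesis .
  qed
  then have pos: "chebyshev m s > 0" by (rule less_le_trans[rotated]) simp
  define \<phi> where "\<phi> x = chebyshev m (s * cos (\<theta> * x)) / chebyshev m s" for x
  show ?thesis
  proof
    show "continuous_on UNIV \<phi>" unfolding \<phi>_def using pos by (intro continuous_intros) auto
    show "\<phi> 0 = 1" using pos by (simp add: \<phi>_def)
    show "\<bar>\<phi> x\<bar> \<le> 1" for x
    proof -
      have "\<bar>s * cos (\<theta> * x)\<bar> \<le> s * 1" unfolding abs_mult using s by (intro mult_mono) auto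
      then show ?thesis using abs_chebyshev_le[of "s * cos (\<theta> * x)" s m] s pos
        by (simp add: \<phi>_def abs_divide)
    qed
    show "\<bar>\<phi> x\<bar> \<le> 2 * exp (- a * real n)" if "real n \<le> \<bar>x\<bar>" "\<bar>x\<bar> \<le> real R" for x
    proof -
      have "\<bar>\<theta> * x\<bar> = \<theta> * \<bar>x\<bar>" using \<theta> by (simp add: abs_mult)
      moreover have "\<theta> * real n \<le> \<theta> * \<bar>x\<bar>" "\<theta> * \<bar>x\<bar> \<le> \<theta> * real R"
        using that \<theta> by (auto intro!: mult_left_mono)
      ultimately have "\<bar>cos (\<theta> * x)\<bar> \<le> cos (\<theta> * real n)"
        using le \<theta> small by (intro abs_cos_le_cos) (auto simp: algebra_simps)
      then have "\<bar>s * cos (\<theta> * x)\<bar> \<le> 1" using c by (simp add: s_def abs_divide)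
      then have "\<bar>chebyshev m (s * cos (\<theta> * x))\<bar> \<le> 1" by (rule abs_chebyshev_le_1)
      then have "\<bar>\<phi> x\<bar> \<le> 1 / chebyshev m s" using pos by (simp add: \<phi>_def abs_divide divide_right_mono)
      also have "\<dots> \<le> 1 / (exp (a * real n) / 2)" using big by (intro divide_left_mono) (auto intro: mult_pos_pos pos)
      finally show ?thesis by (simp add: exp_minus field_simps)
    qed
    show "reproduces t a (\<lambda>x. of_real (\<phi> x))" if "0 \<le> t" "t \<le> 1" for t
    proof -
      have "reproduces t a (\<lambda>x. of_real (1 / chebyshev m s) * of_real (chebyshev m (s * cos (\<theta> * x)))
         + 0 * of_real (chebyshev m (s * cos (\<theta> * x))))"
        using reproduces_chebyshev[OF that \<theta>(1), of m s] unfolding \<theta>(2) by (intro reproduces_linear)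
      then show ?thesis by (simp add: \<phi>_def)
    qed
  qed
qed

section \<open>Approximation by exponentials with frequencies in \<open>J n\<close>\<close>

text \<open>By comparison with the telescoping sum of \<open>2 / i - 2 / (i + 1)\<close>.\<close>

lemma sum_inverse_squares_le:
  assumes "1 \<le> r" "r \<le> N"
  shows "(\<Sum>i=r..<N. 1 / (real i)\<^sup>2) \<le> 2 / real r"
proof -
  have "(\<Sum>i=r..<N. 1 / (real i)\<^sup>2) \<le> 2 / real r - 2 / real N"
    using assms(2,1)
  proof (induction N rule: dec_induct)
    case base
    then show ?case by simp
  next
    case (step N)
    then have N: "real N \<ge> 1" by simp
    have "1 / (real N)\<^sup>2 \<le> 2 / real N - 2 / real (Suc N)"
      using N by (simp add: divide_simps power2_eq_square)
    then show ?case using step by simp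
  qed
  moreover have "0 \<le> 2 / real N" by simp
  ultimately show ?thesis by linarith
qed

text \<open>Both the \<open>j \<le> -r\<close> and the \<open>j \<ge> r + 1\<close> are at distances at least \<open>r, r + 1, \<dots>\<close> from \<open>t \<in> [0, 1]\<close>: the set
\<open>J r\<close> is symmetric about the midpoint of \<open>[0, 1]\<close>.\<close>

lemma sinc_square_tail_le:
  assumes t: "0 \<le> t" "t \<le> (1::real)" and r: "1 \<le> r" "r \<le> N"
  shows "(\<Sum>j\<in>J N - J r. (sinc (pi * (t - real_of_int j)))\<^sup>2) \<le> 4 / (pi\<^sup>2 * real r)"
proof -
  have bound: "(sinc (pi * x))\<^sup>2 \<le> 1 / pi\<^sup>2 * (1 / (real i)\<^sup>2)" if "real i \<le> \<bar>x\<bar>" "1 \<le> i" for x i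
  proof -
    have "x \<noteq> 0" using that by auto
    then have "(sinc (pi * x))\<^sup>2 = 1 / pi\<^sup>2 * ((sin (pi * x))\<^sup>2 / \<bar>x\<bar>\<^sup>2)"
      by (simp add: power_mult_distrib power_divide)
    also have "\<dots> \<le> 1 / pi\<^sup>2 * (1 / (real i)\<^sup>2)"
      using that by (intro mult_left_mono frac_le power_mono) (auto simp: abs_square_le_1)
    finally show ?thesis .
  qed
  have split: "J N - J r = {- int N + 1..- int r} \<union> {int r + 1..int N}" using r by (auto simp: J_def)
  have "(\<Sum>j\<in>J N - J r. (sinc (pi * (t - real_of_int j)))\<^sup>2)
     = (\<Sum>j\<in>{- int N + 1..- int r}. (sinc (pi * (t - real_of_int j)))\<^sup>2)
     + (\<Sum>j\<in>{int r + 1..int N}. (sinc (pi * (t - real_of_int j)))\<^sup>2)"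
    unfolding split by (rule sum.union_disjoint) (use r in auto)
  also have "(\<Sum>j\<in>{- int N + 1..- int r}. (sinc (pi * (t - real_of_int j)))\<^sup>2)
     = (\<Sum>i=r..<N. (sinc (pi * (t + real i)))\<^sup>2)"
    by (rule sum.reindex_bij_witness[where i="\<lambda>i. - int i" and j="\<lambda>j. nat (-j)"]) (use r in auto)
  also have "(\<Sum>j\<in>{int r + 1..int N}. (sinc (pi * (t - real_of_int j)))\<^sup>2)
     = (\<Sum>i=r..<N. (sinc (pi * (t - real i - 1)))\<^sup>2)"
    by (rule sum.reindex_bij_witness[where i="\<lambda>i. int i + 1" and j="\<lambda>j. nat (j - 1)"]) (use r in \<open>auto simp: algebra_simps\<close>)
  also have "(\<Sum>i=r..<N. (sinc (pi * (t + real i)))\<^sup>2) + (\<Sum>i=r..<N. (sinc (pi * (t - real i - 1)))\<^sup>2)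
     \<le> (\<Sum>i=r..<N. 1 / pi\<^sup>2 * (1 / (real i)\<^sup>2)) + (\<Sum>i=r..<N. 1 / pi\<^sup>2 * (1 / (real i)\<^sup>2))"
    using t r by (intro add_mono sum_mono bound) auto
  also have "\<dots> = 2 / pi\<^sup>2 * (\<Sum>i=r..<N. 1 / (real i)\<^sup>2)" by (simp add: sum_distrib_left)
  also have "\<dots> \<le> 2 / pi\<^sup>2 * (2 / real r)" by (intro mult_left_mono sum_inverse_squares_le r) auto
  finally show ?thesis by simp
qed

text \<open>Split the error into the coefficients outside \<open>J n\<close> and the error of a partial series over \<open>J N\<close> with \<open>N\<close>
huge. By orthogonality the former contribute to the square of the norm at most \<open>32 E\<close> from \<open>J R - J n\<close>, where the window is small, and
\<open>E\<close> from \<open>J N - J R\<close>, where \<open>R\<close> is large; here \<open>E = exp (- a n) / (pi n)\<close>. The latter error tends to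
\<open>0\<close>. The window, and with it the coefficients as functions of \<open>t\<close>, depends on \<open>R\<close> but not on \<open>N\<close>, so \<open>N\<close> may be chosen
after \<open>t\<close>.\<close>

lemma trigonometric_approximation:
  fixes n :: nat and \<delta> :: real
  assumes "1 \<le> n" "0 \<le> \<delta>" "\<delta> \<le> pi"
  obtains c :: "int \<Rightarrow> real \<Rightarrow> real" where "\<And>j. continuous_on UNIV (c j)"
    "\<And>t. 0 \<le> t \<Longrightarrow> t \<le> 1 \<Longrightarrow>
      integral {-\<delta>..\<delta>} (\<lambda>\<xi>. (norm (cis (t * \<xi>) - (\<Sum>j\<in>J n. of_real (c j t) * cis (real_of_int j * \<xi>))))\<^sup>2)
      \<le> 75 / 2 * (exp (- (pi - \<delta>) * real n) / (pi * real n))"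
proof -
  define a where "a = pi - \<delta>"
  define E where "E = exp (- a * real n) / (pi * real n)"
  have n: "real n > 0" and a: "0 \<le> a" using assms by (auto simp: a_def)
  have E: "E > 0" using n by (simp add: E_def)
  \<comment> \<open>With this choice the far part of the tail is at most \<open>E\<close>.\<close>
  obtain R :: nat where R: "8 * real n * exp (a * real n) \<le> real R" using real_arch_simple by blast
  have "1 * real n \<le> (8 * exp (a * real n)) * real n"
  proof (intro mult_right_mono)
    have "1 \<le> exp (a * real n)" using a n by simp
    then show "1 \<le> 8 * exp (a * real n)" by linarith
  qed (use n in auto)
  then have "n \<le> R" using R by (simp add: mult_ac)
  then have R1: "1 \<le> R" using assms by simp
  have farE: "8 / (pi * real R) \<le> E"
  proof -
    have "8 / (pi * real R) \<le> 8 / (pi * (8 * real n * exp (a * real n)))"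
      using R n R1 by (intro divide_left_mono mult_left_mono) (auto intro!: mult_pos_pos)
    then show ?thesis by (simp add: E_def exp_minus field_simps)
  qed
  obtain \<phi> :: "real \<Rightarrow> real" where \<phi>: "continuous_on UNIV \<phi>" "\<phi> 0 = 1" "\<And>x. \<bar>\<phi> x\<bar> \<le> 1"
    "\<And>x. real n \<le> \<bar>x\<bar> \<Longrightarrow> \<bar>x\<bar> \<le> real R \<Longrightarrow> \<bar>\<phi> x\<bar> \<le> 2 * exp (- a * real n)"
    "\<And>t. 0 \<le> t \<Longrightarrow> t \<le> 1 \<Longrightarrow> reproduces t a (\<lambda>x. of_real (\<phi> x))"
    by (rule chebyshev_window[OF a \<open>n \<le> R\<close>]) blast
  define c where "c j t = \<phi> (t - real_of_int j) * sinc (pi * (t - real_of_int j))" for j t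
  show ?thesis
  proof
    show "continuous_on UNIV (c j)" for j
      unfolding c_def
      by (intro continuous_intros continuous_on_compose2[OF \<phi>(1)]) auto
    fix t :: real assume t: "0 \<le> t" "t \<le> 1"
    let ?I = "{-\<delta>..\<delta>}"
    let ?T = "\<lambda>A \<xi>. \<Sum>j\<in>A. of_real (c j t) * cis (real_of_int j * \<xi>)"
    have series: "windowed_series (\<lambda>x. of_real (\<phi> x)) t A = ?T A" for A
      by (simp add: windowed_series_def c_def fun_eq_iff)
    have "(\<lambda>k. integral ?I (series_error (\<lambda>x. of_real (\<phi> x)) t k)) \<longlonglongrightarrow> 0"
      using \<phi>(5)[OF t] by (simp add: reproduces_def a_def)
    then have "\<forall>\<^sub>F k in sequentially. integral ?I (series_error (\<lambda>x. of_real (\<phi> x)) t k) < E / 10"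
      using E by (intro order_tendstoD) auto
    then obtain k where k: "R \<le> k" "integral ?I (series_error (\<lambda>x. of_real (\<phi> x)) t k) < E / 10"
      unfolding eventually_sequentially by (meson linear)
    define N :: nat where "N = 2 ^ k"
    have N: "R \<le> N" using order_trans[OF k(1) less_imp_le[OF less_exp]] by (simp add: N_def)
    have sub: "J n \<subseteq> J R" "J R \<subseteq> J N" using \<open>n \<le> R\<close> N by (auto simp: J_def)
    have coeffs: "(\<Sum>j\<in>J N - J n. (c j t)\<^sup>2)
       \<le> 4 * exp (- a * real n) * (4 / (pi\<^sup>2 * real n)) + 4 / (pi\<^sup>2 * real R)"
    proof -
      have "(\<Sum>j\<in>J N - J n. (c j t)\<^sup>2) = (\<Sum>j\<in>J R - J n. (c j t)\<^sup>2) + (\<Sum>j\<in>J N - J R. (c j t)\<^sup>2)"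
        using sub by (subst sum.union_disjoint[symmetric]) (auto intro!: sum.cong)
      also have "\<dots> \<le> (\<Sum>j\<in>J R - J n. 4 * exp (- a * real n) * (sinc (pi * (t - real_of_int j)))\<^sup>2)
         + (\<Sum>j\<in>J N - J R. 1 * (sinc (pi * (t - real_of_int j)))\<^sup>2)"
      proof (intro add_mono sum_mono)
        fix j assume j: "j \<in> J R - J n"
        have "real n \<le> \<bar>t - real_of_int j\<bar>" "\<bar>t - real_of_int j\<bar> \<le> real R"
        proof -
          have "- int R + 1 \<le> j" "j \<le> int R" "j \<le> - int n \<or> int n + 1 \<le> j" using j by (auto simp: J_def)
          then have "- real R + 1 \<le> real_of_int j" "real_of_int j \<le> real R"
            "real_of_int j \<le> - real n \<or> real n + 1 \<le> real_of_int j" by linarith+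
          then show "real n \<le> \<bar>t - real_of_int j\<bar>" "\<bar>t - real_of_int j\<bar> \<le> real R" using t by auto
        qed
        then have "\<bar>\<phi> (t - real_of_int j)\<bar> \<le> 2 * exp (- a * real n)" by (rule \<phi>(4))
        then have "\<bar>\<phi> (t - real_of_int j)\<bar>\<^sup>2 \<le> (2 * exp (- a * real n))\<^sup>2" by (intro power_mono) auto
        also have "\<dots> = 4 * (exp (- a * real n) * exp (- a * real n))" by (simp add: power2_eq_square)
        also have "\<dots> \<le> 4 * (exp (- a * real n) * 1)" using a n by (intro mult_left_mono) auto
        finally have "(\<phi> (t - real_of_int j))\<^sup>2 \<le> 4 * exp (- a * real n)" by simp
        then show "(c j t)\<^sup>2 \<le> 4 * exp (- a * real n) * (sinc (pi * (t - real_of_int j)))\<^sup>2"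
          unfolding c_def power_mult_distrib by (intro mult_right_mono) auto
      next
        fix j
        have "(\<phi> (t - real_of_int j))\<^sup>2 \<le> 1" using \<phi>(3) by (simp add: abs_square_le_1)
        then show "(c j t)\<^sup>2 \<le> 1 * (sinc (pi * (t - real_of_int j)))\<^sup>2"
          unfolding c_def power_mult_distrib by (intro mult_right_mono) auto
      qed
      also have "\<dots> \<le> 4 * exp (- a * real n) * (4 / (pi\<^sup>2 * real n)) + 4 / (pi\<^sup>2 * real R)"
        unfolding sum_distrib_left[symmetric] mult_1
        by (intro add_mono mult_left_mono sinc_square_tail_le t assms R1 \<open>n \<le> R\<close> N) auto
      finally show ?thesis .
    qed
    have cont: "continuous_on S (?T A)" for S A by (intro continuous_intros)
    have tail: "integral ?I (\<lambda>\<xi>. (norm (?T (J N - J n) \<xi>))\<^sup>2) \<le> 33 * E"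
    proof -
      have "integral ?I (\<lambda>\<xi>. (norm (?T (J N - J n) \<xi>))\<^sup>2) \<le> integral {-pi..pi} (\<lambda>\<xi>. (norm (?T (J N - J n) \<xi>))\<^sup>2)"
        using assms by (intro integral_subset_le integrable_continuous_interval continuous_intros) auto
      also have "\<dots> = 2 * pi * (\<Sum>j\<in>J N - J n. (c j t)\<^sup>2)"
        by (intro integral_unique has_integral_norm_trig_polynomial) simp
      also have "\<dots> \<le> 2 * pi * (4 * exp (- a * real n) * (4 / (pi\<^sup>2 * real n)) + 4 / (pi\<^sup>2 * real R))"
        by (intro mult_left_mono coeffs) auto
      also have "\<dots> = 32 * E + 8 / (pi * real R)"
        using n R1 by (simp add: E_def field_simps power2_eq_square)
      also have "\<dots> \<le> 33 * E" using farE by simp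
      finally show ?thesis .
    qed
    have "(norm (cis (t * \<xi>) - ?T (J n) \<xi>))\<^sup>2
       \<le> 11 / 10 * (norm (?T (J N - J n) \<xi>))\<^sup>2 + 11 * series_error (\<lambda>x. of_real (\<phi> x)) t k \<xi>" for \<xi>
    proof -
      \<comment> \<open>The weights give the main term a factor close to 1, as \<open>11 / 10 * 33 + 11 / 10 \<le> 75 / 2\<close>.\<close>
      have quad: "(x + y)\<^sup>2 \<le> 11 / 10 * x\<^sup>2 + 11 * y\<^sup>2" for x y :: real
        using zero_le_power2[of "x - 10 * y"] by (simp add: power2_eq_square algebra_simps)
      have "?T (J N) \<xi> = ?T (J n) \<xi> + ?T (J N - J n) \<xi>"
        using sub by (subst sum.union_disjoint[symmetric]) (auto intro!: sum.cong)
      then have "norm (cis (t * \<xi>) - ?T (J n) \<xi>)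
         = norm (?T (J N - J n) \<xi> + (cis (t * \<xi>) - ?T (J N) \<xi>))" by simp
      also have "\<dots> \<le> norm (?T (J N - J n) \<xi>) + norm (cis (t * \<xi>) - ?T (J N) \<xi>)"
        by (rule norm_triangle_ineq)
      finally have "(norm (cis (t * \<xi>) - ?T (J n) \<xi>))\<^sup>2
         \<le> (norm (?T (J N - J n) \<xi>) + norm (cis (t * \<xi>) - ?T (J N) \<xi>))\<^sup>2" by (intro power_mono) auto
      also note quad
      finally show ?thesis by (simp add: series_error_def series \<phi>(2) N_def)
    qed
    then have "integral ?I (\<lambda>\<xi>. (norm (cis (t * \<xi>) - ?T (J n) \<xi>))\<^sup>2)
       \<le> integral ?I (\<lambda>\<xi>. 11 / 10 * (norm (?T (J N - J n) \<xi>))\<^sup>2 + 11 * series_error (\<lambda>x. of_real (\<phi> x)) t k \<xi>)"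
      by (intro integral_le integrable_continuous_interval continuous_intros continuous_on_series_error)
    also have "\<dots> = 11 / 10 * integral ?I (\<lambda>\<xi>. (norm (?T (J N - J n) \<xi>))\<^sup>2)
       + 11 * integral ?I (series_error (\<lambda>x. of_real (\<phi> x)) t k)"
      by (subst integral_add)
         (auto intro!: integrable_continuous_interval continuous_intros continuous_on_series_error)
    also have "\<dots> \<le> 11 / 10 * (33 * E) + 11 * (E / 10)"
      using tail k(2) by (intro add_mono mult_left_mono) auto
    also have "\<dots> \<le> 75 / 2 * E" using E by simp
    finally show "integral ?I (\<lambda>\<xi>. (norm (cis (t * \<xi>) - ?T (J n) \<xi>))\<^sup>2)
       \<le> 75 / 2 * (exp (- (pi - \<delta>) * real n) / (pi * real n))" by (simp add: E_def a_def)
  qed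
qed

section \<open>Linear functionals on a reproducing kernel Hilbert space\<close>

context reproducing_kernel_Hilbert_space
begin

lemma ip_zero_left: "h \<in> H \<Longrightarrow> ip (\<lambda>t. 0) h = 0"
  using ip_scale[of "\<lambda>t. 0" h 0] zero_mem by simp

lemma ip_add_right: "f \<in> H \<Longrightarrow> g \<in> H \<Longrightarrow> h \<in> H \<Longrightarrow> ip h (\<lambda>t. f t + g t) = ip h f + ip h g"
  by (metis (no_types, lifting) add_mem complex_cnj_add ip_add ip_commute)

lemma ip_scale_right: "f \<in> H \<Longrightarrow> g \<in> H \<Longrightarrow> ip g (\<lambda>t. c * f t) = cnj c * ip g f"
  by (metis (no_types, lifting) scale_mem complex_cnj_mult ip_scale ip_commute)

lemma ip_self_real: "f \<in> H \<Longrightarrow> ip f f = of_real (Re (ip f f))"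
  using ip_commute[of f f] by (simp add: complex_eq_iff)

lemma Cauchy_Schwarz_ip:
  assumes f: "f \<in> H" and g: "g \<in> H"
  shows "(norm (ip f g))\<^sup>2 \<le> Re (ip f f) * Re (ip g g)"
proof (cases "ip g g = 0")
  case True
  then have "ip f g = 0"
    using ip_definite[OF g] ip_commute[OF f g] ip_zero_left[OF f] by simp
  then show ?thesis using True by simp
next
  case False
  define G where "G = Re (ip g g)"
  have G: "ip g g = of_real G" "G > 0"
    using ip_self_real[OF g] False ip_nonneg[OF g] unfolding G_def
    by (auto simp: less_le)
  define c where "c = - ip f g / of_real G"
  let ?h = "\<lambda>t. f t + c * g t"
  have h: "?h \<in> H" and cg: "(\<lambda>t. c * g t) \<in> H" by (intro add_mem scale_mem f g)+
  have "ip ?h ?h = (ip f f + cnj c * ip f g) + (c * ip g f + c * (cnj c * ip g g))"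
    using f g h cg
    by (simp add: ip_add[OF f cg h] ip_scale[OF g h] ip_add_right[OF f cg] ip_scale_right algebra_simps)
  also have "cnj c * ip f g = - of_real ((norm (ip f g))\<^sup>2 / G)"
    using complex_norm_square[of "ip f g"] by (simp add: c_def mult.commute)
  also have "c * ip g f + c * (cnj c * ip g g) = 0"
    using G ip_commute[OF g f] by (simp add: c_def field_simps)
  finally have "0 \<le> Re (ip f f) - (norm (ip f g))\<^sup>2 / G"
    using ip_nonneg[OF h] by simp
  then show ?thesis using G unfolding G_def[symmetric] by (simp add: field_simps)
qed

lemma kernel_sum:
  assumes "finite I"
  shows "(\<lambda>s. \<Sum>i\<in>I. w i * K (p i) s) \<in> H"
    and "h \<in> H \<Longrightarrow> ip (\<lambda>s. \<Sum>i\<in>I. w i * K (p i) s) h = (\<Sum>i\<in>I. w i * ip (K (p i)) h)"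
proof -
  have "(\<lambda>s. \<Sum>i\<in>I. w i * K (p i) s) \<in> H \<and>
    (\<forall>h\<in>H. ip (\<lambda>s. \<Sum>i\<in>I. w i * K (p i) s) h = (\<Sum>i\<in>I. w i * ip (K (p i)) h))"
    using assms
  proof (induction I rule: finite_induct)
    case empty
    then show ?case by (simp add: zero_mem ip_zero_left)
  next
    case (insert i I)
    have "(\<lambda>s. w i * K (p i) s) \<in> H" by (intro scale_mem kernel_mem)
    with insert show ?case
      by (simp add: add_mem ip_add ip_scale kernel_mem)
  qed
  then show "(\<lambda>s. \<Sum>i\<in>I. w i * K (p i) s) \<in> H"
    "h \<in> H \<Longrightarrow> ip (\<lambda>s. \<Sum>i\<in>I. w i * K (p i) s) h = (\<Sum>i\<in>I. w i * ip (K (p i)) h)" by auto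
qed

text \<open>The functional \<open>f \<mapsto> \<Sum>i\<in>I. cnj (w i) * f (p i)\<close> is the inner product with \<open>\<Sum>i\<in>I. w i * K (p i)\<close>, and
the quadratic form of the kernel is the squared norm of this element.\<close>

lemma kernel_combination_bound:
  assumes "f \<in> H" "finite I" "Re (ip f f) \<le> 1"
  shows "(norm (\<Sum>i\<in>I. cnj (w i) * f (p i)))\<^sup>2
     \<le> Re (\<Sum>i\<in>I. \<Sum>k\<in>I. w i * cnj (w k) * K (p i) (p k))"
proof -
  let ?g = "\<lambda>s. \<Sum>i\<in>I. w i * K (p i) s"
  have g: "?g \<in> H" by (rule kernel_sum[OF assms(2)])
  have right: "ip h ?g = (\<Sum>i\<in>I. cnj (w i) * h (p i))" if h: "h \<in> H" for h
  proof -
    have "ip h ?g = cnj (\<Sum>i\<in>I. w i * ip (K (p i)) h)"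
      using ip_commute[OF h g] kernel_sum(2)[OF assms(2) h] by simp
    also have "\<dots> = (\<Sum>i\<in>I. cnj (w i) * h (p i))"
      using h kernel_mem by (auto simp: reproducing[OF h] ip_commute[OF h] intro!: sum.cong)
    finally show ?thesis .
  qed
  have "ip ?g ?g = (\<Sum>k\<in>I. cnj (w k) * (\<Sum>i\<in>I. w i * K (p i) (p k)))"
    using right[OF g] .
  also have "\<dots> = (\<Sum>i\<in>I. \<Sum>k\<in>I. w i * cnj (w k) * K (p i) (p k))"
    unfolding sum_distrib_left by (subst sum.swap) (simp add: mult_ac)
  finally have "ip ?g ?g = \<dots>" .
  moreover have "Re (ip f f) * Re (ip ?g ?g) \<le> 1 * Re (ip ?g ?g)"
    by (intro mult_right_mono assms ip_nonneg g)
  ultimately show ?thesis using Cauchy_Schwarz_ip[OF assms(1) g] right[OF assms(1)] by simp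
qed

end

lemma rkhs_unit_ball_functional_bound:
  assumes "f \<in> rkhs_unit_ball K" "finite I"
  shows "(norm (\<Sum>i\<in>I. cnj (w i) * f (p i)))\<^sup>2
     \<le> Re (\<Sum>i\<in>I. \<Sum>k\<in>I. w i * cnj (w k) * K (p i) (p k))"
proof -
  from assms(1) obtain H ip where *: "reproducing_kernel_Hilbert_space K H ip" "f \<in> H"
    "sqrt (Re (ip f f)) \<le> 1" unfolding rkhs_unit_ball_def by auto
  interpret reproducing_kernel_Hilbert_space K H ip by fact
  show ?thesis using * by (intro kernel_combination_bound assms(2)) auto
qed

text \<open>For a kernel with spectral density \<open>\<rho>\<close>, the quadratic form is the integral of \<open>\<bar>\<Sum>i\<in>I. w i exp (\<i> p i \<xi>)\<bar>\<^sup>2\<close>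
against \<open>\<rho>\<close>.\<close>

lemma spectral_quadratic_form_le:
  fixes \<rho> :: "real \<Rightarrow> real" and w :: "'i \<Rightarrow> complex" and p :: "'i \<Rightarrow> real" and \<delta> :: real
    and K :: "real \<Rightarrow> real \<Rightarrow> complex"
  defines "\<mu> \<equiv> lebesgue_on {-\<delta>..\<delta>}"
  assumes "finite I" and \<rho>: "\<rho> \<in> borel_measurable \<mu>" "AE \<xi> in \<mu>. 0 \<le> \<rho> \<xi>" "AE \<xi> in \<mu>. \<rho> \<xi> \<le> D"
    and K: "\<And>t \<tau>. K t \<tau> = (LINT \<xi>|\<mu>. exp (\<i> * of_real ((t - \<tau>) * \<xi>)) * of_real (\<rho> \<xi>))"
  shows "Re (\<Sum>i\<in>I. \<Sum>k\<in>I. w i * cnj (w k) * K (p i) (p k))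
     \<le> D * integral {-\<delta>..\<delta>} (\<lambda>\<xi>. (norm (\<Sum>i\<in>I. w i * cis (p i * \<xi>)))\<^sup>2)"
proof -
  let ?F = "\<lambda>\<xi>. (norm (\<Sum>i\<in>I. w i * cis (p i * \<xi>)))\<^sup>2"
  have meas: "f \<in> borel_measurable \<mu>" if "continuous_on UNIV f" for f :: "real \<Rightarrow> 'b::{euclidean_space}"
    unfolding \<mu>_def
    by (intro continuous_imp_measurable_on_sets_lebesgue continuous_on_subset[OF that]) auto
  interpret finite_measure \<mu>
    unfolding \<mu>_def by (rule finite_measure_lebesgue_on) auto
  have int: "integrable \<mu> (\<lambda>\<xi>. exp (\<i> * of_real (x * \<xi>)) * of_real (\<rho> \<xi>))" for x
  proof (rule integrable_const_bound)
    show "AE \<xi> in \<mu>. norm (exp (\<i> * of_real (x * \<xi>)) * of_real (\<rho> \<xi>)) \<le> D"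
      using \<rho>(2,3) by eventually_elim (simp add: norm_mult)
    show "(\<lambda>\<xi>. exp (\<i> * of_real (x * \<xi>)) * complex_of_real (\<rho> \<xi>)) \<in> borel_measurable \<mu>"
      by (intro borel_measurable_times[OF meas measurable_compose[OF \<rho>(1) borel_measurable_of_real]] continuous_intros)
  qed
  have Fint: "integrable \<mu> ?F"
    unfolding \<mu>_def by (intro continuous_imp_integrable_real continuous_intros)
  have F: "(\<Sum>i\<in>I. \<Sum>k\<in>I. w i * cnj (w k) * (exp (\<i> * of_real ((p i - p k) * \<xi>)) * of_real (\<rho> \<xi>)))
     = of_real (?F \<xi> * \<rho> \<xi>)" for \<xi>
  proof -
    have "exp (\<i> * of_real ((p i - p k) * \<xi>)) = cis (p i * \<xi>) * cnj (cis (p k * \<xi>))" for i k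
      unfolding cis_conv_exp[symmetric] by (simp add: cis_cnj cis_mult left_diff_distrib)
    then have "(\<Sum>i\<in>I. \<Sum>k\<in>I. w i * cnj (w k) * (exp (\<i> * of_real ((p i - p k) * \<xi>)) * of_real (\<rho> \<xi>)))
      = (\<Sum>i\<in>I. w i * cis (p i * \<xi>)) * cnj (\<Sum>i\<in>I. w i * cis (p i * \<xi>)) * of_real (\<rho> \<xi>)"
      by (subst sum.swap) (simp add: sum_distrib_left sum_distrib_right mult_ac)
    then show ?thesis unfolding complex_norm_square[symmetric] by simp
  qed
  have "(\<Sum>i\<in>I. \<Sum>k\<in>I. w i * cnj (w k) * K (p i) (p k))
     = (LINT \<xi>|\<mu>. (\<Sum>i\<in>I. \<Sum>k\<in>I. w i * cnj (w k) * (exp (\<i> * of_real ((p i - p k) * \<xi>)) * of_real (\<rho> \<xi>))))"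
  proof -
    define e where "e i k \<xi> = exp (\<i> * of_real ((p i - p k) * \<xi>)) * complex_of_real (\<rho> \<xi>)" for i k \<xi>
    have "integrable \<mu> (e i k)" for i k using int[of "p i - p k"] by (simp add: e_def[abs_def])
    then show ?thesis
      unfolding K e_def[symmetric] by (simp add: Bochner_Integration.integral_sum)
  qed
  also have "\<dots> = of_real (LINT \<xi>|\<mu>. ?F \<xi> * \<rho> \<xi>)"
    unfolding F by (rule integral_complex_of_real)
  finally have "Re (\<Sum>i\<in>I. \<Sum>k\<in>I. w i * cnj (w k) * K (p i) (p k)) = (LINT \<xi>|\<mu>. ?F \<xi> * \<rho> \<xi>)" by simp
  also have "\<dots> \<le> (LINT \<xi>|\<mu>. D * ?F \<xi>)"
  proof (rule integral_mono_AE)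
    show "AE \<xi> in \<mu>. ?F \<xi> * \<rho> \<xi> \<le> D * ?F \<xi>"
      using \<rho>(3) by eventually_elim (simp add: mult.commute[of D] mult_left_mono)
    show "integrable \<mu> (\<lambda>\<xi>. D * ?F \<xi>)" using Fint by simp
    show "integrable \<mu> (\<lambda>\<xi>. ?F \<xi> * \<rho> \<xi>)"
    proof (rule Bochner_Integration.integrable_bound)
      show "integrable \<mu> (\<lambda>\<xi>. D * ?F \<xi>)" using Fint by simp
      show "(\<lambda>\<xi>. ?F \<xi> * \<rho> \<xi>) \<in> borel_measurable \<mu>" using Fint \<rho>(1) by measurable
      show "AE \<xi> in \<mu>. norm (?F \<xi> * \<rho> \<xi>) \<le> norm (D * ?F \<xi>)"
        using \<rho>(2,3) by eventually_elim (simp add: abs_mult mult.commute[of D] mult_left_mono)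
    qed
  qed
  also have "\<dots> = D * integral {-\<delta>..\<delta>} ?F"
    using Fint unfolding \<mu>_def by (simp add: lebesgue_integral_eq_integral)
  finally show ?thesis .
qed

text \<open>The sum of \<open>f\<close> at \<open>t\<close> with weight \<open>1\<close> and at the nodes \<open>p j\<close> with weights \<open>- c j\<close> is indexed by an option
type, so that \<open>t\<close> may coincide with a node.\<close>

lemma rkhs_combination_error:
  fixes K :: "real \<Rightarrow> real \<Rightarrow> complex" and \<rho> c p :: "_ \<Rightarrow> real"
  assumes f: "f \<in> rkhs_unit_ball K"
    and "finite A"
    and \<rho>: "\<rho> \<in> borel_measurable (lebesgue_on {-\<delta>..\<delta>})" "AE \<xi> in lebesgue_on {-\<delta>..\<delta>}. 0 \<le> \<rho> \<xi>"
      "AE \<xi> in lebesgue_on {-\<delta>..\<delta>}. \<rho> \<xi> \<le> D"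
    and K: "\<And>t \<tau>. K t \<tau> =
      (LINT \<xi>|lebesgue_on {-\<delta>..\<delta>}. exp (\<i> * of_real ((t - \<tau>) * \<xi>)) * of_real (\<rho> \<xi>))"
  shows "(norm (f t - (\<Sum>j\<in>A. of_real (c j) * f (p j))))\<^sup>2
    \<le> D * integral {-\<delta>..\<delta>} (\<lambda>\<xi>. (norm (cis (t * \<xi>) - (\<Sum>j\<in>A. of_real (c j) * cis (p j * \<xi>))))\<^sup>2)"
proof -
  define I where "I = insert None (Some ` A)"
  define q where "q i = (case i of None \<Rightarrow> t | Some j \<Rightarrow> p j)" for i
  define w :: "_ \<Rightarrow> complex" where "w i = (case i of None \<Rightarrow> 1 | Some j \<Rightarrow> - of_real (c j))" for i
  have I: "finite I" using \<open>finite A\<close> by (simp add: I_def)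
  have sum_I: "(\<Sum>i\<in>I. g i) = g None + (\<Sum>j\<in>A. g (Some j))" for g :: "_ \<Rightarrow> complex"
    using \<open>finite A\<close> by (simp add: I_def sum.reindex)
  have "(norm (\<Sum>i\<in>I. cnj (w i) * f (q i)))\<^sup>2 \<le> Re (\<Sum>i\<in>I. \<Sum>k\<in>I. w i * cnj (w k) * K (q i) (q k))"
    by (rule rkhs_unit_ball_functional_bound[OF f I])
  also have "\<dots> \<le> D * integral {-\<delta>..\<delta>} (\<lambda>\<xi>. (norm (\<Sum>i\<in>I. w i * cis (q i * \<xi>)))\<^sup>2)"
    by (rule spectral_quadratic_form_le[OF I \<rho> K])
  finally show ?thesis by (simp add: sum_I w_def q_def sum_negf)
qed

lemma norm_cis_diff_le: "norm (cis x - cis y) \<le> \<bar>x - y\<bar>"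
proof -
  have "cis x - cis y = cis y * (exp (\<i> * of_real (x - y)) - 1)"
    unfolding cis_conv_exp[symmetric] by (simp add: cis_mult right_diff_distrib)
  then have "norm (cis x - cis y) = 2 * \<bar>sin ((x - y) / 2)\<bar>"
    using dist_exp_i_1[of "x - y"] by (simp only: norm_mult norm_cis mult_1)
  then show ?thesis using abs_sin_x_le_abs_x[of "(x - y) / 2"] by simp
qed

text \<open>Continuity is used only to know that the error function is measurable: the essential supremum of a
non-measurable function is \<open>\<infinity>\<close> by convention.\<close>

lemma rkhs_unit_ball_continuous:
  fixes K :: "real \<Rightarrow> real \<Rightarrow> complex" and \<rho> :: "real \<Rightarrow> real"
  assumes f: "f \<in> rkhs_unit_ball K" and \<delta>: "0 \<le> \<delta>" and "0 \<le> D"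
    and \<rho>: "\<rho> \<in> borel_measurable (lebesgue_on {-\<delta>..\<delta>})" "AE \<xi> in lebesgue_on {-\<delta>..\<delta>}. 0 \<le> \<rho> \<xi>"
      "AE \<xi> in lebesgue_on {-\<delta>..\<delta>}. \<rho> \<xi> \<le> D"
    and K: "\<And>t \<tau>. K t \<tau> =
      (LINT \<xi>|lebesgue_on {-\<delta>..\<delta>}. exp (\<i> * of_real ((t - \<tau>) * \<xi>)) * of_real (\<rho> \<xi>))"
  shows "continuous_on S f"
proof -
  define L where "L = sqrt (D * (2 * \<delta> * \<delta>\<^sup>2))"
  have L: "0 \<le> L" using assms by (simp add: L_def)
  have lip: "norm (f t - f s) \<le> L * \<bar>t - s\<bar>" for s t
  proof -
    have "(norm (f t - f s))\<^sup>2 \<le> D * integral {-\<delta>..\<delta>} (\<lambda>\<xi>. (norm (cis (t * \<xi>) - cis (s * \<xi>)))\<^sup>2)"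
      using rkhs_combination_error[OF f _ \<rho> K, of "{()}" t "\<lambda>_. 1" "\<lambda>_. s"] by simp
    also have "\<dots> \<le> D * integral {-\<delta>..\<delta>} (\<lambda>\<xi>. (\<bar>t - s\<bar> * \<delta>)\<^sup>2)"
    proof (intro mult_left_mono integral_le integrable_continuous_interval continuous_intros power_mono)
      fix \<xi> assume "\<xi> \<in> {-\<delta>..\<delta>}"
      then have "\<bar>t - s\<bar> * \<bar>\<xi>\<bar> \<le> \<bar>t - s\<bar> * \<delta>" by (intro mult_left_mono) auto
      then show "norm (cis (t * \<xi>) - cis (s * \<xi>)) \<le> \<bar>t - s\<bar> * \<delta>"
        using norm_cis_diff_le[of "t * \<xi>" "s * \<xi>"] by (simp add: abs_mult flip: left_diff_distrib)
    qed (use assms in auto)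
    also have "\<dots> = (L * \<bar>t - s\<bar>)\<^sup>2"
      using assms by (simp add: L_def power_mult_distrib power2_eq_square)
    finally show ?thesis by (rule power2_le_imp_le) (use L in simp)
  qed
  have "L-lipschitz_on S f"
    by (rule lipschitz_onI) (use lip L in \<open>simp_all add: dist_norm\<close>)
  then show ?thesis by (rule lipschitz_on_continuous_on)
qed

section \<open>The recovery error\<close>

lemma Linf_norm_leI:
  assumes "f \<in> borel_measurable M" "\<And>x. x \<in> space M \<Longrightarrow> norm (f x) \<le> B"
  shows "Linf_norm M f \<le> ennreal B"
  unfolding Linf_norm_def
  by (rule esssup_I) (use assms in \<open>auto intro!: AE_I2 ennreal_leI\<close>)

text \<open>Drop \<open>pi - \<delta> \<ge> 0\<close> from \<open>2 + pi - \<delta>\<close> and use \<open>e \<ge> 5 / 2\<close>: the constant is then \<open>2 * 3 * 25 / 4 = 75 / 2\<close>.\<close>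

lemma approximation_constant_le:
  fixes n :: nat and \<delta> :: real
  assumes "1 \<le> n" "\<delta> \<le> pi"
  shows "75 / 2 * (exp (- (pi - \<delta>) * real n) / (pi * real n))
    \<le> (sqrt (2 + pi - \<delta>) * (sqrt 3 * exp 1 / sqrt (pi * real n)) * exp (- ((pi - \<delta>) / 2 * real n)))\<^sup>2"
proof -
  have "(5 / 2 :: real) \<le> exp 1"
    using exp_lower_Taylor_quadratic[of "1::real"] by simp
  then have "(5 / 2)\<^sup>2 \<le> (exp 1 :: real)\<^sup>2" by (intro power_mono) auto
  then have "2 * (3 * (5 / 2)\<^sup>2) \<le> (2 + pi - \<delta>) * (3 * (exp 1)\<^sup>2)"
    using assms by (intro mult_mono) auto
  then have "75 / 2 \<le> (2 + pi - \<delta>) * (3 * (exp 1)\<^sup>2)" by (simp add: power2_eq_square)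
  then have le: "75 / 2 * (exp (- (pi - \<delta>) * real n) / (pi * real n))
     \<le> (2 + pi - \<delta>) * (3 * (exp 1)\<^sup>2) * (exp (- (pi - \<delta>) * real n) / (pi * real n))"
    by (intro mult_right_mono) auto
  have sq: "exp (- (pi - \<delta>) * real n) = (exp (- ((pi - \<delta>) / 2 * real n)))\<^sup>2"
    by (simp add: power2_eq_square algebra_simps flip: exp_add)
  have "(2 + pi - \<delta>) * (3 * (exp 1)\<^sup>2) * (exp (- (pi - \<delta>) * real n) / (pi * real n))
    = (sqrt (2 + pi - \<delta>) * (sqrt 3 * exp 1 / sqrt (pi * real n)) * exp (- ((pi - \<delta>) / 2 * real n)))\<^sup>2"
    unfolding sq using assms by (simp add: power_mult_distrib power_divide)
  with le show ?thesis by simp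
qed

theorem theorem2p4:
  fixes M :: "'a measure"
    and X :: "real \<Rightarrow> 'a \<Rightarrow> complex"
    and \<delta> :: real
    and \<rho> :: "real \<Rightarrow> real"
    and n :: nat
  assumes "0 < \<delta>" and "\<delta> \<le> pi"
    and "wide_sense_stationary M X"
    and "(\<lambda>t. autocorrelation M X t 0) \<in> paley_wiener \<delta>"
    and "AE \<xi> in lebesgue_on {-\<delta>..\<delta>}. 0 \<le> \<rho> \<xi>"
    and "\<rho> \<in> L2_space (lebesgue_on {-\<delta>..\<delta>})"
    and "L2_norm (lebesgue_on {-\<delta>..\<delta>}) \<rho> > 0"
    and "\<And>t \<tau>. autocorrelation M X t \<tau> =
           (LINT \<xi>|lebesgue_on {-\<delta>..\<delta>}. exp (\<i> * of_real ((t - \<tau>) * \<xi>)) * of_real (\<rho> \<xi>))"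
    and "\<rho> \<in> Linf_space (lebesgue_on {-\<delta>..\<delta>})"
    and "n \<ge> 1"
  shows "min_recovery_error n (autocorrelation M X) \<le>
    Linf_norm (lebesgue_on {-\<delta>..\<delta>}) (\<lambda>\<xi>. sqrt (\<rho> \<xi>)) *
    ennreal (sqrt (2 + pi - \<delta>) * (sqrt 3 * exp 1 / sqrt (pi * real n)) *
      exp (- ((pi - \<delta>) / 2 * real n)))"
proof -
  let ?\<mu> = "lebesgue_on {-\<delta>..\<delta>}"
  define B where "B = sqrt (2 + pi - \<delta>) * (sqrt 3 * exp 1 / sqrt (pi * real n)) *
      exp (- ((pi - \<delta>) / 2 * real n))"
  have B: "0 \<le> B" using assms(2) by (simp add: B_def)
  have \<rho>: "\<rho> \<in> borel_measurable ?\<mu>" "Linf_norm ?\<mu> \<rho> < \<infinity>"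
    using assms(9) by (auto simp: Linf_space_def)
  define C where "C = enn2real (Linf_norm ?\<mu> (\<lambda>\<xi>. sqrt (\<rho> \<xi>)))"
  have C: "Linf_norm ?\<mu> (\<lambda>\<xi>. sqrt (\<rho> \<xi>)) = ennreal C"
  proof -
    define D where "D = enn2real (Linf_norm ?\<mu> \<rho>)"
    have "Linf_norm ?\<mu> \<rho> = ennreal D" using \<rho>(2) by (simp add: D_def less_top)
    then have "AE \<xi> in ?\<mu>. ennreal (norm (\<rho> \<xi>)) \<le> ennreal D"
      using esssup_AE[where M="?\<mu>" and f="\<lambda>\<xi>. ennreal (norm (\<rho> \<xi>))"] by (simp add: Linf_norm_def)
    then have "AE \<xi> in ?\<mu>. ennreal (norm (sqrt (\<rho> \<xi>))) \<le> ennreal (sqrt D)"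
      using assms(5) by eventually_elim (simp add: D_def)
    then have "Linf_norm ?\<mu> (\<lambda>\<xi>. sqrt (\<rho> \<xi>)) \<le> ennreal (sqrt D)"
      unfolding Linf_norm_def using \<rho>(1) by (intro esssup_I) auto
    then have "Linf_norm ?\<mu> (\<lambda>\<xi>. sqrt (\<rho> \<xi>)) < top" using ennreal_less_top le_less_trans by blast
    then show ?thesis by (simp add: C_def)
  qed
  have C0: "0 \<le> C" by (simp add: C_def)
  have \<rho>C: "AE \<xi> in ?\<mu>. \<rho> \<xi> \<le> C\<^sup>2"
  proof -
    have "AE \<xi> in ?\<mu>. ennreal (norm (sqrt (\<rho> \<xi>))) \<le> ennreal C"
      using esssup_AE[where M="?\<mu>" and f="\<lambda>\<xi>. ennreal (norm (sqrt (\<rho> \<xi>)))"] C by (simp add: Linf_norm_def)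
    then show ?thesis using assms(5)
    proof eventually_elim
      case (elim \<xi>)
      then have "sqrt (\<rho> \<xi>) \<le> C" using C0 by simp
      then show ?case using elim by (metis real_sqrt_le_iff real_sqrt_abs sqrt_le_D)
    qed
  qed
  obtain c :: "int \<Rightarrow> real \<Rightarrow> real" where c: "\<And>j. continuous_on UNIV (c j)"
    "\<And>t. 0 \<le> t \<Longrightarrow> t \<le> 1 \<Longrightarrow>
      integral {-\<delta>..\<delta>} (\<lambda>\<xi>. (norm (cis (t * \<xi>) - (\<Sum>j\<in>J n. of_real (c j t) * cis (real_of_int j * \<xi>))))\<^sup>2)
      \<le> 75 / 2 * (exp (- (pi - \<delta>) * real n) / (pi * real n))"
    by (rule trigonometric_approximation[OF assms(10) less_imp_le[OF assms(1)] assms(2)]) blast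
  define \<A> :: "(int \<Rightarrow> complex) \<Rightarrow> real \<Rightarrow> complex"
    where "\<A> g t = (\<Sum>j\<in>J n. of_real (c j t) * g j)" for g t
  have \<A>_cont: "continuous_on UNIV (\<A> g)" for g
    unfolding \<A>_def by (intro continuous_intros c(1))
  have \<A>_meas: "\<A> g \<in> borel_measurable (lebesgue_on {0..1})" for g
    by (intro continuous_imp_measurable_on_sets_lebesgue continuous_on_subset[OF \<A>_cont]) auto
  have "\<A> g \<in> Linf_space (lebesgue_on {0..1})" for g
  proof -
    have "compact (\<A> g ` {0..1})"
      by (intro compact_continuous_image continuous_on_subset[OF \<A>_cont]) auto
    then obtain b where b: "\<forall>x\<in>{0..1}. norm (\<A> g x) \<le> b"
      using compact_imp_bounded bounded_iff by (metis imageI)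
    have "Linf_norm (lebesgue_on {0..1}) (\<A> g) \<le> ennreal b"
      using b by (intro Linf_norm_leI \<A>_meas) auto
    then have "Linf_norm (lebesgue_on {0..1}) (\<A> g) < top" using ennreal_less_top le_less_trans by blast
    then show ?thesis using \<A>_meas by (simp add: Linf_space_def)
  qed
  then have \<A>: "\<A> \<in> recovery_maps n" by (simp add: recovery_maps_def)
  have pointwise: "norm (f t - \<A> (restrict (\<lambda>j. f (of_int j)) (J n)) t) \<le> C * B"
    if f: "f \<in> rkhs_unit_ball (autocorrelation M X)" and t: "t \<in> {0..1}" for f t
  proof -
    have "(norm (f t - (\<Sum>j\<in>J n. of_real (c j t) * f (of_int j))))\<^sup>2
       \<le> C\<^sup>2 * integral {-\<delta>..\<delta>} (\<lambda>\<xi>. (norm (cis (t * \<xi>) - (\<Sum>j\<in>J n. of_real (c j t) * cis (real_of_int j * \<xi>))))\<^sup>2)"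
      by (rule rkhs_combination_error[OF f finite_J \<rho>(1) assms(5) \<rho>C assms(8)])
    also have "\<dots> \<le> C\<^sup>2 * B\<^sup>2"
      unfolding B_def using c(2)[of t] t approximation_constant_le[OF assms(10,2)] by (intro mult_left_mono) auto
    finally have "(norm (f t - (\<Sum>j\<in>J n. of_real (c j t) * f (of_int j))))\<^sup>2 \<le> (C * B)\<^sup>2"
      by (simp add: power_mult_distrib)
    then have "norm (f t - (\<Sum>j\<in>J n. of_real (c j t) * f (of_int j))) \<le> C * B"
      by (rule power2_le_imp_le) (use B C0 in simp)
    then show ?thesis by (simp add: \<A>_def)
  qed
  have "recovery_error n \<A> (autocorrelation M X) \<le> ennreal (C * B)"
    unfolding recovery_error_def
  proof (rule SUP_least)
    fix f assume f: "f \<in> rkhs_unit_ball (autocorrelation M X)"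
    show "Linf_norm (lebesgue_on {0..1}) (\<lambda>t. f t - \<A> (restrict (\<lambda>j. f (of_int j)) (J n)) t) \<le> ennreal (C * B)"
    proof (rule Linf_norm_leI)
      have "continuous_on {0..1} f"
        using assms(1) by (intro rkhs_unit_ball_continuous[OF f _ _ \<rho>(1) assms(5) \<rho>C assms(8)]) auto
      then show "(\<lambda>t. f t - \<A> (restrict (\<lambda>j. f (of_int j)) (J n)) t) \<in> borel_measurable (lebesgue_on {0..1})"
        by (intro continuous_imp_measurable_on_sets_lebesgue continuous_on_diff
              continuous_on_subset[OF \<A>_cont]) auto
    qed (use pointwise[OF f] in auto)
  qed
  then have "min_recovery_error n (autocorrelation M X) \<le> ennreal (C * B)"
    unfolding min_recovery_error_def using \<A> by (rule INF_lower2[rotated])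
  then show ?thesis unfolding C B_def[symmetric] using C0 by (simp add: ennreal_mult')
qed

end
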